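(* Let $K$ be an imaginary quadratic field and let $\mathcal{O}_K$ be its ring of integers. Then there does not exist a Diophantine $m$-tuple in $\mathcal{O}_K$ with $D(-1)$ for $m > 36$.
   Context: A set $\{a_1, a_2, \dots, a_m\} \subset \mathcal{O}_K \setminus \{0\}$ of $m$ (distinct) elements is called a Diophantine $m$-tuple in $\mathcal{O}_K$ with $D(-1)$ if for all $1 \leq i < j \leq m$ there exists $x_{ij} \in \mathcal{O}_K$ such that $a_i a_j - 1 = x_{ij}^2$. *)

theory Defs
  imports "HOL-Analysis.Analysis" "HOL-Computational_Algebra.Polynomial"
begin

text \<open>Number fields are taken as subfields of the complex numbers. Closure under inverses needs
  no exception for 0, since \<^prop>\<open>inverse (0::complex) = 0\<close>.\<close>

definition complex_subfield :: "complex set \<Rightarrow> bool" where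
  "complex_subfield K \<longleftrightarrow>
     1 \<in> K \<and>
     (\<forall>x\<in>K. \<forall>y\<in>K. x - y \<in> K \<and> x * y \<in> K) \<and>
     (\<forall>x\<in>K. inverse x \<in> K)"

lemma vector_space_rat_complex: "vector_space (\<lambda>(q::rat) (z::complex). of_rat q * z)"
  by unfold_locales (simp_all add: algebra_simps of_rat_add of_rat_mult)

definition degree_over_rat :: "complex set \<Rightarrow> nat" where
  "degree_over_rat K = vector_space.dim (\<lambda>(q::rat) (z::complex). of_rat q * z) K"

text \<open>The library's dimension of an infinite-dimensional space is 0, so the condition
  \<^prop>\<open>degree_over_rat K = 2\<close> does assert that the degree is finite.\<close>

definition imaginary_quadratic_field :: "complex set \<Rightarrow> bool" where
  "imaginary_quadratic_field K \<longleftrightarrow>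
     complex_subfield K \<and> degree_over_rat K = 2 \<and> \<not> K \<subseteq> \<real>"

definition ring_of_integers :: "complex set \<Rightarrow> complex set" where
  "ring_of_integers K = {x \<in> K. algebraic_int x}"

text \<open>As \<^prop>\<open>a * b - 1 = x\<^sup>2\<close> is symmetric in \<^term>\<open>a\<close> and \<^term>\<open>b\<close>, the condition
  on index pairs \<open>i < j\<close> is the condition on pairs of distinct elements.\<close>

definition diophantine_tuple_minus_one :: "complex set \<Rightarrow> nat \<Rightarrow> complex set \<Rightarrow> bool" where
  "diophantine_tuple_minus_one R m A \<longleftrightarrow>
     finite A \<and> card A = m \<and> A \<subseteq> R - {0} \<and>
     (\<forall>a\<in>A. \<forall>b\<in>A. a \<noteq> b \<longrightarrow> (\<exists>x\<in>R. a * b - 1 = x\<^sup>2))"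

end

theory Submission
  imports Defs "HOL-Computational_Algebra.Field_as_Ring" "HOL-Computational_Algebra.Polynomial_Factorial"
begin

text \<open>The elements of a tuple \<open>A\<close> are forced to grow very fast in absolute value, faster than is possible.

The integers of \<open>K\<close> form a ring \<open>R\<close> in which nonzero elements have absolute value at least 1 (locale
\<open>quadratic_order\<close>). Let \<open>a, b, c \<in> A\<close> with \<open>a b - 1 = r\<^sup>2\<close>, \<open>a c - 1 = s\<^sup>2\<close>, \<open>b c - 1 = t\<^sup>2\<close>. The two
numbers \<open>2 a b c - (a + b + c) \<plusminus> 2 r s t\<close> of \<open>R\<close> have the product \<open>(c - a - b)\<^sup>2 - 4 (a b - 1)\<close>. Unless
this product is zero, neither factor is small, and comparing sum and product gives a gap:
\<open>\<bar>c\<bar> \<ge> 2 \<bar>a b\<bar>\<close> when \<open>3 \<le> \<bar>a\<bar> \<le> \<bar>b\<bar> \<le> \<bar>c\<bar>\<close> (\<open>gap_principle\<close>). The exceptional triples are rare, and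
at most 20 elements have absolute value below 3 (\<open>card_small_diophantine_le_20\<close>). So among 37 elements
there are 17 large ones, and after leaving out two exceptional ones the logarithms of the absolute values grow at least
like Fibonacci numbers. This produces \<open>a, b, c, d\<close> with \<open>\<bar>c\<bar>\<close> larger than a constant times \<open>\<bar>b\<bar> ^ 34\<close>
and \<open>\<bar>d\<bar> \<ge> \<bar>c\<bar> ^ 8\<close> (\<open>fast_growing_quadruple\<close>).

Such quadruples do not exist (\<open>no_far_extension\<close>). The square roots of \<open>a d - 1\<close>, \<open>b d - 1\<close>, \<open>c d - 1\<close> in
\<open>R\<close> yield simultaneous approximations to the square roots of \<open>1 - 1 / (a c)\<close> and \<open>1 - 1 / (b c)\<close> with
a common denominator, of a quality of about \<open>1 / \<bar>d\<bar>\<close> with denominator about \<open>\<bar>c d\<bar> ^ (1/2)\<close>. Both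
numbers are values of one function of \<open>v\<close>, the square root of \<open>1 - v / c\<close>, at \<open>v = 1 / a\<close> and \<open>v = 1 / b\<close>,
and its value at \<open>v = 0\<close> is 1. Divided differences of \<open>(1 - v / c) ^ (k + 1/2)\<close> at these three nodes,
with multiplicities about \<open>k\<close>, are linear forms in 1 and the two square roots with coefficients of degree
\<open>k\<close> in \<open>1 / c\<close> but values of order \<open>c ^ (- 3 k)\<close>; they are the Pade approximants of the problem.
Inserting the approximations and clearing denominators gives, for the right \<open>k\<close>, elements of \<open>R\<close> of
absolute value below 1, hence zero. That three
neighbouring forms cannot vanish together is shown by a differential equation for the interpolating
polynomial (\<open>divided_differences_not_all_zero\<close>).\<close>

section \<open>The ring of integers as a discrete ring\<close>

text \<open>Everything that the proof uses about \<open>K\<close> is that its ring of integers has these properties. They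
make it a discrete set: a nonzero element has a positive integer as the square of its absolute value.\<close>

locale quadratic_order =
  fixes R :: "complex set"
  assumes one_mem: "1 \<in> R"
    and diff_mem: "x \<in> R \<Longrightarrow> y \<in> R \<Longrightarrow> x - y \<in> R"
    and mult_mem: "x \<in> R \<Longrightarrow> y \<in> R \<Longrightarrow> x * y \<in> R"
    and trace_int: "x \<in> R \<Longrightarrow> 2 * Re x \<in> \<int>"
    and norm_int: "x \<in> R \<Longrightarrow> (cmod x)\<^sup>2 \<in> \<int>"
begin

lemma zero_mem: "0 \<in> R"
  using diff_mem[OF one_mem one_mem] by simp

lemma uminus_mem: "x \<in> R \<Longrightarrow> - x \<in> R"
  using diff_mem[OF zero_mem, of x] by simp

lemma add_mem: "x \<in> R \<Longrightarrow> y \<in> R \<Longrightarrow> x + y \<in> R"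
  using diff_mem[OF _ uminus_mem, of x y] by simp

lemma power_mem: "x \<in> R \<Longrightarrow> x ^ n \<in> R"
  by (induction n) (auto simp: one_mem mult_mem)

lemma of_nat_mem: "of_nat n \<in> R"
  by (induction n) (auto simp: zero_mem one_mem add_mem)

lemma int_mem: "x \<in> \<int> \<Longrightarrow> x \<in> R"
  by (auto elim!: Ints_cases) (metis of_int_of_nat_eq of_int_minus of_nat_mem uminus_mem int_cases2)

lemma numeral_mem: "numeral n \<in> R"
  using of_nat_mem[of "numeral n"] by simp

lemma norm_ge_1:
  assumes "x \<in> R" "x \<noteq> 0"
  shows "1 \<le> cmod x"
proof -
  obtain n where n: "(cmod x)\<^sup>2 = of_int n"
    using norm_int[OF assms(1)] by (auto elim: Ints_cases)
  have "(0::real) < of_int n"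
    unfolding n[symmetric] using assms(2) by simp
  then have "(1::real) \<le> of_int n"
    by simp
  then have "1\<^sup>2 \<le> (cmod x)\<^sup>2"
    by (simp add: n)
  then show ?thesis
    by (rule power2_le_imp_le) simp
qed

lemma eq_0_if_norm_less_1: "x \<in> R \<Longrightarrow> cmod x < 1 \<Longrightarrow> x = 0"
  using norm_ge_1 by fastforce

end

text \<open>Gauss's lemma: the primitive integer multiple \<open>q\<close> of the minimal polynomial
\<open>X\<^sup>2 - 2 Re z X + \<bar>z\<bar>\<^sup>2\<close> divides some multiple of the monic polynomial \<open>P\<close>; comparing contents and
leading coefficients shows that the leading coefficient of \<open>q\<close> is a unit.\<close>

lemma trace_norm_Ints_if_monic_int_root:
  fixes P :: "int poly"
  assumes monic: "lead_coeff P = 1"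
    and root: "poly (map_poly of_int P) z = (0::complex)"
    and nonreal: "z \<notin> \<real>"
    and trace: "2 * Re z \<in> \<rat>" and norm: "(cmod z)\<^sup>2 \<in> \<rat>"
  shows "2 * Re z \<in> \<int> \<and> (cmod z)\<^sup>2 \<in> \<int>"
proof -
  obtain t1 t2 where t: "2 * Re z = of_int t1 / of_int t2" "t2 > 0"
    using trace by (elim Rats_cases') auto
  obtain n1 n2 where n: "(cmod z)\<^sup>2 = of_int n1 / of_int n2" "n2 > 0"
    using norm by (elim Rats_cases') auto
  define q0 :: "int poly" where "q0 = [: n1 * t2, - (t1 * n2), n2 * t2 :]"
  define q where "q = primitive_part q0"
  have q0: "q0 \<noteq> 0" "degree q0 = 2"
    using t n by (simp_all add: q0_def)
  have cq: "content q = 1"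
    using q0 by (simp add: q_def)
  have qq: "q0 = smult (content q0) q"
    by (simp add: q_def)
  have c0: "content q0 \<noteq> 0"
    using q0 by simp
  have dq: "degree q = 2"
    using q0 by (simp add: q_def)
  define u where "u = coeff q 2"
  have u0: "u \<noteq> 0"
    using dq by (auto simp: u_def) (metis coeff_0_degree_minus_1 degree_0 leading_coeff_0_iff zero_neq_numeral)
  have c: "n1 * t2 = content q0 * coeff q 0" "- (t1 * n2) = content q0 * coeff q 1"
      "n2 * t2 = content q0 * u"
    using arg_cong[OF qq, of "\<lambda>p. coeff p 0"] arg_cong[OF qq, of "\<lambda>p. coeff p 1"]
      arg_cong[OF qq, of "\<lambda>p. coeff p 2"]
    by (simp_all add: q0_def u_def numeral_2_eq_2)
  have N: "of_int (coeff q 0) = of_int u * (cmod z)\<^sup>2"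
  proof -
    have "of_int (content q0) * (of_int (coeff q 0) :: real) = of_int n1 * of_int t2"
      by (simp add: c flip: of_int_mult)
    also have "\<dots> = (cmod z)\<^sup>2 * of_int (n2 * t2)"
      using n by simp
    also have "\<dots> = of_int (content q0) * (of_int u * (cmod z)\<^sup>2)"
      unfolding c by simp
    finally show ?thesis
      using c0 by simp
  qed
  have T: "of_int (coeff q 1) = - of_int u * (2 * Re z)"
  proof -
    have "of_int (content q0) * (of_int (coeff q 1) :: real) = - (of_int t1 * of_int n2)"
      by (simp add: c flip: of_int_mult of_int_minus)
    also have "\<dots> = - (2 * Re z) * of_int (n2 * t2)"
      using t by simp
    also have "\<dots> = of_int (content q0) * (- of_int u * (2 * Re z))"
      unfolding c by simp
    finally show ?thesis
      using c0 by (subst (asm) mult_cancel_left) simp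
  qed
  have qz: "poly (map_poly of_int q) z = 0"
  proof -
    have e1: "map_poly of_int q = [: of_int (coeff q 0), of_int (coeff q 1), of_int u :: complex :]"
      using dq by (intro poly_eqI) (auto simp: coeff_map_poly coeff_pCons u_def coeff_eq_0 eval_nat_numeral split: nat.splits)
    have e2: "of_int (coeff q 0) = (of_int u * (z * cnj z) :: complex)"
      using arg_cong[OF N, of complex_of_real] by (simp add: complex_norm_square[symmetric] del: of_real_power)
    have e3: "of_int (coeff q 1) = (- of_int u * (z + cnj z) :: complex)"
      using arg_cong[OF T, of complex_of_real] by (simp add: complex_add_cnj)
    show ?thesis
      unfolding e1 e2 e3 by (simp add: algebra_simps)
  qed
  have "q \<noteq> 0"
    using dq by auto
  then obtain a A where a: "a \<noteq> 0" "smult a P = q * A + pseudo_mod P q"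
    and r: "pseudo_mod P q = 0 \<or> degree (pseudo_mod P q) < 2"
    using pseudo_mod[of q P] dq by auto
  define r where "r = pseudo_mod P q"
  \<comment> \<open>a real polynomial of degree at most 1 with the nonreal root \<open>z\<close> is zero\<close>
  have "r = 0"
  proof (rule ccontr)
    assume "r \<noteq> 0"
    have "poly (map_poly of_int (smult a P)) z = poly (map_poly of_int (q * A + r)) z"
      using a by (simp add: r_def)
    moreover have "map_poly of_int (smult a P) = smult (of_int a) (map_poly of_int P :: complex poly)"
      by (intro poly_eqI) (simp add: coeff_map_poly)
    moreover have "map_poly of_int (q * A + r) = map_poly of_int q * map_poly of_int A + (map_poly of_int r :: complex poly)"
      by (intro poly_eqI) (simp add: coeff_map_poly coeff_mult)
    ultimately have rz: "poly (map_poly of_int r) z = 0"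
      using root qz by simp
    have "map_poly of_int r = [: of_int (coeff r 0), of_int (coeff r 1) :: complex :]"
      using r \<open>r \<noteq> 0\<close> unfolding r_def
      by (intro poly_eqI) (auto simp: coeff_map_poly coeff_pCons coeff_eq_0 split: nat.splits)
    with rz have e: "of_int (coeff r 0) + z * of_int (coeff r 1) = 0"
      by simp
    have "coeff r 1 = 0"
    proof (rule ccontr)
      assume "coeff r 1 \<noteq> 0"
      with e have "z = - of_int (coeff r 0) / of_int (coeff r 1)"
        by (simp add: field_simps eq_neg_iff_add_eq_0)
      then show False
        using nonreal by (auto simp: complex_is_Real_iff)
    qed
    with e have "coeff r 0 = 0"
      by simp
    moreover have "coeff r i = 0" if "i \<ge> 2" for i
      using r \<open>r \<noteq> 0\<close> that unfolding r_def by (auto intro: coeff_eq_0)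
    ultimately have "r = 0"
      using \<open>coeff r 1 = 0\<close>
      by (intro poly_eqI) (metis One_nat_def coeff_0 less_2_cases not_le numeral_2_eq_2)
    with \<open>r \<noteq> 0\<close> show False
      by simp
  qed
  with a have aP: "smult a P = q * A"
    by (simp add: r_def)
  have "content P = 1"
  proof -
    have "content P dvd 1"
      using content_dvd_coeff[of P "degree P"] monic by simp
    then show ?thesis
      using normalize_content[of P] is_unit_normalize by metis
  qed
  with arg_cong[OF aP, of content] cq have cA: "content A = normalize a"
    by (simp add: content_mult)
  have "lead_coeff (smult a P) = lead_coeff q * lead_coeff A"
    by (simp add: aP lead_coeff_mult)
  then have "a = u * lead_coeff A"
    using monic dq a(1) by (simp add: u_def)
  moreover have "a dvd lead_coeff A"
    using content_dvd_coeff[of A "degree A"] cA by simp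
  then obtain w where "lead_coeff A = a * w"
    by (elim dvdE)
  ultimately have "u * w = 1"
    using a(1) by (simp add: mult.left_commute)
  then have u: "u = 1 \<or> u = -1"
    by (metis zmult_eq_1_iff)
  then have "(cmod z)\<^sup>2 = of_int (u * coeff q 0)" "2 * Re z = of_int (- u * coeff q 1)"
    using N T by auto
  then show ?thesis
    by (metis Ints_of_int)
qed

text \<open>As \<open>K\<close> has dimension 2, it is spanned by 1 and any nonreal \<open>w \<in> K\<close>. Comparing the relation
\<open>w\<^sup>2 = p + q w\<close> with its complex conjugate gives \<open>w + cnj w = q\<close>, so that traces and norms of all elements
are rational combinations of \<open>p\<close> and \<open>q\<close>.\<close>

lemma imaginary_quadratic_trace_norm_rat:
  assumes K: "imaginary_quadratic_field K" and x: "x \<in> K"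
  shows "2 * Re x \<in> \<rat> \<and> (cmod x)\<^sup>2 \<in> \<rat>"
proof -
  interpret Q: vector_space "\<lambda>(q::rat) (z::complex). of_rat q * z"
    by (rule vector_space_rat_complex)
  have fld: "complex_subfield K" and dim: "Q.dim K = 2" and nr: "\<not> K \<subseteq> \<real>"
    using K by (simp_all add: imaginary_quadratic_field_def degree_over_rat_def)
  from nr obtain w where w: "w \<in> K" "w \<notin> \<real>"
    by auto
  have K1: "1 \<in> K"
    using fld by (simp add: complex_subfield_def)
  obtain B where B: "B \<subseteq> K" "Q.independent B" "K \<subseteq> Q.span B" "card B = 2"
    using Q.basis_exists[of K] dim by metis
  then have finB: "finite B"
    by (metis card.infinite zero_neq_numeral)
  have of_rat_real: "(of_rat q :: complex) = of_real (of_rat q)" for q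
    by (cases q) (simp add: of_rat_rat)
  have real: "(of_rat q :: complex) \<in> \<real>" for q
    by (simp add: of_rat_real)
  have ind: "Q.independent {w, 1}"
  proof -
    have "w \<notin> Q.span {1}"
      using w real by (auto simp: Q.span_singleton)
    then show ?thesis
      by (simp add: Q.independent_insert)
  qed
  have comb: "\<exists>p q. y = of_rat p + of_rat q * w" if y: "y \<in> K" for y
  proof -
    have "y \<in> Q.span {w, 1}"
    proof (rule ccontr)
      assume n: "y \<notin> Q.span {w, 1}"
      then have "Q.independent {y, w, 1}"
        using ind by (rule Q.independent_insertI)
      moreover have "{y, w, 1} \<subseteq> Q.span B"
        using B w y K1 by auto
      ultimately have "card {y, w, 1} \<le> 2"
        using Q.independent_span_bound[OF finB] B by metis
      moreover have "y \<notin> {w, 1}" "w \<noteq> 1"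
        using n w Q.span_base by auto
      ultimately show False
        by auto
    qed
    then obtain q where "y - of_rat q * w \<in> Q.span {1}"
      by (auto simp: Q.span_breakdown_eq)
    then obtain p where "y - of_rat q * w = of_rat p * 1"
      by (auto simp: Q.span_singleton)
    then show ?thesis
      by (metis diff_add_cancel mult.right_neutral)
  qed
  obtain p q where ww: "w * w = of_rat p + of_rat q * w"
    using comb[of "w * w"] fld w by (auto simp: complex_subfield_def)
  have cnj_rat: "cnj (of_rat s) = of_rat s" for s
    using real by (simp add: Reals_cnj_iff)
  have "cnj w * cnj w = of_rat p + of_rat q * cnj w"
    using arg_cong[OF ww, of cnj] by (simp add: cnj_rat)
  with ww have "(w - cnj w) * (w + cnj w - of_rat q) = 0"
    by (simp add: algebra_simps)
  moreover have "w - cnj w \<noteq> 0"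
    using w by (auto simp: Reals_cnj_iff)
  ultimately have "w + cnj w - of_rat q = 0"
    by simp
  then have cw: "cnj w = of_rat q - w"
    by (simp add: algebra_simps)
  obtain u v where xx: "x = of_rat u + of_rat v * w"
    using comb[OF x] by auto
  have "complex_of_real (2 * Re x) = x + cnj x"
    by (simp add: complex_add_cnj)
  also have "\<dots> = of_rat (2 * u + v * q)"
    by (simp add: xx cnj_rat cw of_rat_add of_rat_mult algebra_simps)
  finally have 1: "2 * Re x = of_rat (2 * u + v * q)"
    by (metis of_real_eq_iff of_rat_real)
  have "complex_of_real ((cmod x)\<^sup>2) = x * cnj x"
    by (rule complex_norm_square)
  also have "\<dots> = of_rat u * of_rat u + of_rat u * of_rat v * of_rat q + of_rat v * of_rat v * (of_rat q * w - w * w)"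
    by (simp add: xx cnj_rat cw algebra_simps)
  also have "of_rat q * w - w * w = - of_rat p"
    by (simp add: ww)
  also have "of_rat u * of_rat u + of_rat u * of_rat v * of_rat q + of_rat v * of_rat v * (- of_rat p)
      = complex_of_real (of_rat (u * u + u * v * q - v * v * p))"
    by (simp add: of_rat_real[symmetric] of_rat_add of_rat_mult of_rat_diff)
  finally have 2: "(cmod x)\<^sup>2 = of_rat (u * u + u * v * q - v * v * p)"
    by (metis of_real_eq_iff)
  show ?thesis
    unfolding 1 2 by auto
qed

lemma ring_of_integers_iff:
  assumes K: "imaginary_quadratic_field K"
  shows "x \<in> ring_of_integers K \<longleftrightarrow> x \<in> K \<and> 2 * Re x \<in> \<int> \<and> (cmod x)\<^sup>2 \<in> \<int>"
proof
  assume "x \<in> ring_of_integers K"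
  then have xK: "x \<in> K" and ai: "algebraic_int x"
    by (simp_all add: ring_of_integers_def)
  note rat = imaginary_quadratic_trace_norm_rat[OF K xK]
  show "x \<in> K \<and> 2 * Re x \<in> \<int> \<and> (cmod x)\<^sup>2 \<in> \<int>"
  proof (cases "x \<in> \<real>")
    case True
    then have xr: "x = of_real (Re x)"
      by simp
    have "Re x = (2 * Re x) / 2"
      by simp
    then have "Re x \<in> \<rat>"
      using rat Rats_divide[of "2 * Re x" 2] Rats_number_of by metis
    moreover have "algebraic_int (Re x)"
      using ai xr by (metis algebraic_int_of_real_iff)
    ultimately have i: "Re x \<in> \<int>"
      by (intro rational_algebraic_int_is_int)
    have "(cmod x)\<^sup>2 = Re x * Re x"
      by (subst xr) (simp add: power2_eq_square)
    with i xK show ?thesis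
      by auto
  next
    case False
    obtain P where "lead_coeff P = 1" "poly (map_poly of_int P) x = 0"
      using ai by (auto simp: algebraic_int_altdef_ipoly)
    with trace_norm_Ints_if_monic_int_root[of P x] False rat xK show ?thesis
      by auto
  qed
next
  assume *: "x \<in> K \<and> 2 * Re x \<in> \<int> \<and> (cmod x)\<^sup>2 \<in> \<int>"
  then obtain t n where t: "2 * Re x = of_int t" and n: "(cmod x)\<^sup>2 = of_int n"
    by (auto elim!: Ints_cases)
  have "of_int t = x + cnj x" "of_int n = x * cnj x"
    using arg_cong[OF t, of complex_of_real] arg_cong[OF n, of complex_of_real]
    by (simp_all add: complex_add_cnj complex_norm_square[symmetric] del: of_real_power)
  then have "poly [: of_int n, - of_int t, 1 :] x = 0"
    by (simp add: algebra_simps)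
  then have "algebraic_int x"
    by (rule algebraic_int.intros[rotated 2])
       (auto simp: coeff_pCons split: nat.splits)
  with * show "x \<in> ring_of_integers K"
    by (simp add: ring_of_integers_def)
qed

lemma Ints_if_sum_prod_Ints:
  fixes s t :: real
  assumes "s \<in> \<rat>" "s + t \<in> \<int>" "s * t \<in> \<int>"
  shows "s \<in> \<int>"
proof -
  have "poly [: s * t, - (s + t), 1 :] s = 0"
    by (simp add: algebra_simps)
  then have "algebraic_int s"
    by (rule algebraic_int.intros[rotated 2])
       (use assms Ints_minus[OF assms(2)] in \<open>auto simp: coeff_pCons split: nat.splits\<close>)
  then show ?thesis
    using assms(1) by (rule rational_algebraic_int_is_int)
qed

text \<open>Closure of the integers of \<open>K\<close> under subtraction and multiplication comes down to the integrality of the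
traces of \<open>x cnj y\<close> and of \<open>x y\<close>. These two rational numbers have an integral sum
\<open>(2 Re x) (2 Re y)\<close> and an integral product, so they are integers.\<close>

lemma quadratic_order_ring_of_integers:
  assumes K: "imaginary_quadratic_field K"
  shows "quadratic_order (ring_of_integers K)"
proof
  note iff = ring_of_integers_iff[OF K]
  have fld: "complex_subfield K"
    using K by (simp add: imaginary_quadratic_field_def)
  show "1 \<in> ring_of_integers K"
    using fld by (auto simp: iff complex_subfield_def)
  fix x assume x: "x \<in> ring_of_integers K"
  show "2 * Re x \<in> \<int>" "(cmod x)\<^sup>2 \<in> \<int>"
    using x by (auto simp: iff)
  fix y assume y: "y \<in> ring_of_integers K"
  have xyK: "x - y \<in> K" "x * y \<in> K"
    using x y fld by (auto simp: iff complex_subfield_def)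
  have cyK: "cnj y \<in> K"
  proof -
    obtain t where "2 * Re y = of_int t"
      using y by (auto simp: iff elim!: Ints_cases)
    then have e: "cnj y = of_int t - y"
      by (simp add: complex_eq_iff)
    have K0: "0 \<in> K" "1 \<in> K"
      using fld by (auto simp: complex_subfield_def) (metis diff_self)
    have diffK: "a - b \<in> K" if "a \<in> K" "b \<in> K" for a b
      using fld that by (auto simp: complex_subfield_def)
    have nat: "of_nat n \<in> K" for n
    proof (induction n)
      case (Suc n)
      have "of_nat (Suc n) = of_nat n - (0 - (1::complex))"
        by simp
      then show ?case
        using diffK[OF Suc diffK[OF K0]] by metis
    qed (use K0 in auto)
    have "of_int t \<in> K"
    proof (cases t)
      case (nonneg n)
      then show ?thesis using nat[of n] by simp
    next
      case (neg n)
      then have "of_int t = 0 - (of_nat (Suc n) :: complex)" by simp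
      then show ?thesis using diffK[OF K0(1) nat] by metis
    qed
    then show ?thesis
      using e diffK y by (auto simp: iff)
  qed
  define t1 t2 where "t1 = 2 * Re (x * cnj y)" and "t2 = 2 * Re (x * y)"
  have rat: "t1 \<in> \<rat>" "t2 \<in> \<rat>"
    using imaginary_quadratic_trace_norm_rat[OF K, of "x * cnj y"]
      imaginary_quadratic_trace_norm_rat[OF K, of "x * y"] cyK x fld xyK
    by (auto simp: t1_def t2_def iff complex_subfield_def)
  have tr: "2 * Re x \<in> \<int>" "2 * Re y \<in> \<int>" and nm: "(cmod x)\<^sup>2 \<in> \<int>" "(cmod y)\<^sup>2 \<in> \<int>"
    using x y by (auto simp: iff)
  have sum: "t1 + t2 \<in> \<int>"
  proof -
    have "t1 + t2 = (2 * Re x) * (2 * Re y)"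
      by (simp add: t1_def t2_def)
    then show ?thesis using tr by (metis Ints_mult)
  qed
  have prod: "t1 * t2 \<in> \<int>"
  proof -
    have "t1 * t2 = (cmod y)\<^sup>2 * ((2 * Re x) * (2 * Re x) - 2 * (cmod x)\<^sup>2)
        + (cmod x)\<^sup>2 * ((2 * Re y) * (2 * Re y) - 2 * (cmod y)\<^sup>2)"
      unfolding cmod_power2 by (simp add: t1_def t2_def algebra_simps power2_eq_square)
    then show ?thesis
      using tr nm by (metis Ints_add Ints_mult Ints_diff Ints_numeral)
  qed
  have t1: "t1 \<in> \<int>"
    by (rule Ints_if_sum_prod_Ints[OF rat(1) sum prod])
  have t2: "t2 \<in> \<int>"
    by (rule Ints_if_sum_prod_Ints[OF rat(2), of t1]) (use sum prod in \<open>simp_all add: ac_simps\<close>)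
  have "(cmod (x - y))\<^sup>2 = (cmod x)\<^sup>2 + (cmod y)\<^sup>2 - t1"
    unfolding cmod_power2 t1_def by (simp add: power2_eq_square algebra_simps)
  moreover have "2 * Re (x - y) = 2 * Re x - 2 * Re y"
    by simp
  ultimately show "x - y \<in> ring_of_integers K"
    using xyK tr nm t1 by (auto simp: iff)
  have "(cmod (x * y))\<^sup>2 = (cmod x)\<^sup>2 * (cmod y)\<^sup>2"
    by (simp add: norm_mult power_mult_distrib)
  then show "x * y \<in> ring_of_integers K"
    using xyK nm t2 by (auto simp: iff t2_def)
qed

section \<open>Counting elements of small absolute value\<close>

text \<open>Half of the integral points with \<open>t\<^sup>2 + 3 k\<^sup>2 \<le> 36\<close> and \<open>t \<equiv> k\<close> modulo 2 (Eisenstein integers, the densest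
case), and half of those with \<open>t\<^sup>2 + 4 k\<^sup>2 \<le> 36\<close> and \<open>t\<close> even (Gaussian integers).\<close>

lemma lattice_points_in_half_disc:
  "length (filter (\<lambda>(t, k). (even (t + k) \<and> t\<^sup>2 + 3 * k\<^sup>2 \<le> 36) \<and> (0 < k \<or> k = 0 \<and> 0 \<le> t))
     (List.product [-6,-5,-4,-3,-2,-1,0,1,2,3,4,5,6::int] [0,1,2,3::int])) \<le> 19"
  "length (filter (\<lambda>(t, k). (even t \<and> t\<^sup>2 + 4 * k\<^sup>2 \<le> 36) \<and> (0 < k \<or> k = 0 \<and> 0 \<le> t))
     (List.product [-6,-5,-4,-3,-2,-1,0,1,2,3,4,5,6::int] [0,1,2,3::int])) \<le> 19"
  by simp_all

context quadratic_order
begin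

text \<open>The imaginary parts form a discrete group, generated by the smallest positive one, \<open>h\<close>. The integer
\<open>D = 4 h\<^sup>2\<close> is the absolute value of the discriminant: if \<open>t\<close> is the trace of an element with imaginary
part \<open>h\<close>, then \<open>t\<^sup>2 + D\<close> is 4 times a norm, which leaves the residues 0 and 3 modulo 4.\<close>

lemma imaginary_parts:
  obtains D :: int and h :: real
  where "3 \<le> D" "D mod 4 = 0 \<or> D mod 4 = 3" "4 * h\<^sup>2 = of_int D"
    "\<And>x. x \<in> R \<Longrightarrow> \<exists>k::int. Im x = of_int k * h"
proof (cases "\<exists>x\<in>R. Im x \<noteq> 0")
  case False
  show ?thesis
  proof
    \<comment> \<open>a real ring has only the imaginary part 0, and any admissible \<open>h\<close> will do\<close>
    show "4 * (sqrt 3 / 2)\<^sup>2 = of_int 3"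
      by (simp add: power_divide)
  next
    fix x assume "x \<in> R"
    with False show "\<exists>k::int. Im x = of_int k * (sqrt 3 / 2)"
      by (intro exI[of _ 0]) auto
  qed auto
next
  case True
  have sq_nat: "\<exists>n::nat. 4 * (Im x)\<^sup>2 = of_nat n" if x: "x \<in> R" for x
  proof -
    have "4 * (Im x)\<^sup>2 = 4 * (cmod x)\<^sup>2 - (2 * Re x)\<^sup>2"
      by (simp add: cmod_power2 power_mult_distrib)
    also have "\<dots> \<in> \<int>"
      using trace_int[OF x] norm_int[OF x] by (metis Ints_diff Ints_mult Ints_power Ints_numeral)
    finally obtain m where m: "4 * (Im x)\<^sup>2 = of_int m"
      by (auto elim: Ints_cases)
    have "(0::real) \<le> of_int m"
      by (simp flip: m)
    then have "4 * (Im x)\<^sup>2 = of_nat (nat m)"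
      using m by simp
    then show ?thesis ..
  qed
  define P where "P n \<longleftrightarrow> 0 < n \<and> (\<exists>x\<in>R. 4 * (Im x)\<^sup>2 = of_nat n)" for n :: nat
  obtain x0 where x0: "x0 \<in> R" "Im x0 \<noteq> 0"
    using True by auto
  obtain n0 where n0: "4 * (Im x0)\<^sup>2 = of_nat n0"
    using sq_nat[OF x0(1)] by auto
  have "(0::real) < of_nat n0"
    using x0 by (simp flip: n0)
  with n0 x0 have "P n0"
    by (auto simp: P_def)
  define d where "d = (LEAST n. P n)"
  have Pd: "P d"
    unfolding d_def using \<open>P n0\<close> by (rule LeastI)
  have least: "d \<le> n" if "P n" for n
    unfolding d_def using that by (rule Least_le)
  obtain w0 where w0: "w0 \<in> R" "4 * (Im w0)\<^sup>2 = of_nat d" and d0: "0 < d"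
    using Pd by (auto simp: P_def)
  define w where "w = (if Im w0 < 0 then - w0 else w0)"
  define h where "h = Im w"
  have w: "w \<in> R" "4 * h\<^sup>2 = of_nat d"
    using w0 uminus_mem by (auto simp: w_def h_def)
  have "Im w0 \<noteq> 0"
    using w0 d0 by auto
  then have h: "0 < h"
    by (auto simp: h_def w_def)
  show ?thesis
  proof
    show "4 * h\<^sup>2 = of_int (int d)"
      using w by simp
    have "int d mod 4 = 0 \<or> int d mod 4 = 3"
    proof -
      obtain t where t: "2 * Re w = of_int t"
        using trace_int[OF w(1)] by (auto elim: Ints_cases)
      obtain n where n: "(cmod w)\<^sup>2 = of_int n"
        using norm_int[OF w(1)] by (auto elim: Ints_cases)
      have "(2 * Re w)\<^sup>2 + 4 * h\<^sup>2 = 4 * (cmod w)\<^sup>2"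
        by (simp add: h_def cmod_power2 power_mult_distrib)
      then have "of_int (t\<^sup>2 + int d) = (of_int (4 * n) :: real)"
        unfolding t n w(2) by simp
      then have e: "t\<^sup>2 + int d = 4 * n"
        by linarith
      show ?thesis
      proof (cases "even t")
        case True
        then obtain s where "t = 2 * s" by (elim evenE)
        with e have "int d = 4 * (n - s\<^sup>2)"
          by (simp add: power_mult_distrib)
        then show ?thesis by simp
      next
        case False
        then obtain s where "t = 2 * s + 1" by (elim oddE)
        with e have "int d = 4 * (n - s\<^sup>2 - s - 1) + 3"
          by (simp add: power2_eq_square algebra_simps)
        then show ?thesis by presburger
      qed
    qed
    then show "int d mod 4 = 0 \<or> int d mod 4 = 3" "3 \<le> int d"
      using d0 by presburger+
    fix x assume x: "x \<in> R"
    define k where "k = \<lfloor>Im x / h\<rfloor>"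
    define y where "y = x - of_int k * w"
    have yR: "y \<in> R"
      unfolding y_def using diff_mem[OF x mult_mem[OF int_mem w(1)]] by auto
    have Imy: "Im y = Im x - of_int k * h"
      by (simp add: y_def h_def)
    have "of_int k \<le> Im x / h" "Im x / h < of_int k + 1"
      unfolding k_def by linarith+
    then have "0 \<le> Im y" "Im y < h"
      using h by (auto simp: Imy field_simps)
    obtain n where n: "4 * (Im y)\<^sup>2 = of_nat n"
      using sq_nat[OF yR] by auto
    have "Im y = 0"
    proof (rule ccontr)
      assume "Im y \<noteq> 0"
      then have "(0::real) < of_nat n"
        by (simp flip: n)
      then have "P n"
        using n yR by (auto simp: P_def)
      then have "real d \<le> real n"
        using least by simp
      then have "h\<^sup>2 \<le> (Im y)\<^sup>2"
        using n w(2) by linarith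
      then show False
        using \<open>0 \<le> Im y\<close> \<open>Im y < h\<close> by (auto dest: power2_le_imp_le)
    qed
    then show "\<exists>k::int. Im x = of_int k * h"
      using Imy by auto
  qed
qed

lemma trace_imaginary_part_parity:
  fixes D t k :: int
  assumes x: "x \<in> R" and D: "D mod 4 = 0 \<or> D mod 4 = 3" "4 * h\<^sup>2 = of_int D"
    and t: "2 * Re x = of_int t" and k: "Im x = of_int k * h"
  shows "of_int (t\<^sup>2 + D * k\<^sup>2) = 4 * (cmod x)\<^sup>2"
    "D mod 4 = 0 \<Longrightarrow> even t" "D mod 4 = 3 \<Longrightarrow> even (t + k)"
proof -
  obtain n where n: "(cmod x)\<^sup>2 = of_int n"
    using norm_int[OF x] by (auto elim: Ints_cases)
  have "of_int (t\<^sup>2 + D * k\<^sup>2) = (2 * Re x)\<^sup>2 + 4 * (of_int k * h)\<^sup>2"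
    unfolding t by (simp add: power_mult_distrib D(2)[symmetric])
  also have "\<dots> = 4 * (cmod x)\<^sup>2"
    by (simp add: cmod_power2 k power_mult_distrib)
  finally show 1: "of_int (t\<^sup>2 + D * k\<^sup>2) = 4 * (cmod x)\<^sup>2" .
  then have e: "t\<^sup>2 + D * k\<^sup>2 = 4 * n"
    unfolding n by linarith
  show "even t" if "D mod 4 = 0"
  proof -
    define E where "E = D div 4"
    have "D = 4 * E"
      unfolding E_def using that by presburger
    then have "t\<^sup>2 = 2 * (2 * n - 2 * E * k\<^sup>2)"
      using e by simp
    then have "even (t\<^sup>2)"
      by simp
    then show ?thesis by simp
  qed
  show "even (t + k)" if "D mod 4 = 3"
  proof -
    have "odd D"
      using that by presburger
    moreover have "even (t\<^sup>2 + D * k\<^sup>2)"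
      by (simp add: e)
    ultimately show ?thesis by auto
  qed
qed

text \<open>An element with trace \<open>t\<close> and imaginary part \<open>k h\<close> has \<open>t\<^sup>2 + D k\<^sup>2\<close> equal to 4 times its norm. So the
elements with norm at most 9 inject into one of two finite sets of points \<open>(t, k)\<close>; counting squares
allows choosing one of each pair \<open>x\<close>, \<open>-x\<close>.\<close>

lemma card_squares_norm_le_9:
  defines "S \<equiv> {x\<^sup>2 | x. x \<in> R \<and> (cmod x)\<^sup>2 \<le> 9}"
  shows "finite S" "card S \<le> 19"
proof -
  obtain D :: int and h where D: "3 \<le> D" "D mod 4 = 0 \<or> D mod 4 = 3" "4 * h\<^sup>2 = of_int D"
    and Im: "\<And>x. x \<in> R \<Longrightarrow> \<exists>k::int. Im x = of_int k * h"
    using imaginary_parts by blast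
  define ok :: "int \<times> int \<Rightarrow> bool" where
    "ok = (\<lambda>(t, k). (if D mod 4 = 3 then even (t + k) \<and> t\<^sup>2 + 3 * k\<^sup>2 \<le> 36
                     else even t \<and> t\<^sup>2 + 4 * k\<^sup>2 \<le> 36) \<and> (0 < k \<or> k = 0 \<and> 0 \<le> t))"
  define xs where "xs = filter ok (List.product [-6,-5,-4,-3,-2,-1,0,1,2,3,4,5,6::int] [0,1,2,3::int])"
  define F where "F = (\<lambda>(t, k). (Complex (of_int t / 2) (of_int k * h))\<^sup>2)"
  have "S \<subseteq> F ` set xs"
  proof
    fix s assume "s \<in> S"
    then obtain x0 where x0: "s = x0\<^sup>2" "x0 \<in> R" "(cmod x0)\<^sup>2 \<le> 9"
      by (auto simp: S_def)
    define x where "x = (if (\<exists>k::int. Im x0 = of_int k * h \<and> 0 < k) \<or> Im x0 = 0 \<and> 0 \<le> Re x0 then x0 else - x0)"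
    have x: "s = x\<^sup>2" "x \<in> R" "(cmod x)\<^sup>2 \<le> 9"
      using x0 uminus_mem by (auto simp: x_def)
    have h0: "h \<noteq> 0"
      using D by auto
    obtain k0 :: int where k0: "Im x0 = of_int k0 * h"
      using Im x0 by blast
    obtain t where t: "2 * Re x = of_int t"
      using trace_int[OF x(2)] by (auto elim: Ints_cases)
    define k where "k = (if x = x0 then k0 else - k0)"
    have k: "Im x = of_int k * h"
      using k0 by (auto simp: k_def x_def)
    have half: "0 < k \<or> k = 0 \<and> 0 \<le> t"
    proof (cases "(\<exists>k::int. Im x0 = of_int k * h \<and> 0 < k) \<or> Im x0 = 0 \<and> 0 \<le> Re x0")
      case True
      then have "x = x0" "k = k0"
        by (auto simp: x_def k_def)
      with True k0 h0 t show ?thesis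
        by auto
    next
      case False
      then have e: "x = - x0"
        by (auto simp: x_def)
      have "k0 \<le> 0"
        using False k0 by (meson linorder_not_le)
      show ?thesis
      proof (cases "k0 = 0")
        case True
        then have "Re x0 < 0"
          using False k0 by auto
        with e t have "(0::real) < of_int t"
          by simp
        with True show ?thesis
          by (auto simp: k_def)
      next
        case k00: False
        then have "x \<noteq> x0"
          using e k0 h0 by (auto simp: complex_eq_iff)
        with k00 \<open>k0 \<le> 0\<close> show ?thesis
          by (simp add: k_def)
      qed
    qed
    note par = trace_imaginary_part_parity[OF x(2) D(2,3) t k]
    have "of_int (t\<^sup>2 + D * k\<^sup>2) \<le> (of_int 36 :: real)"
      using par(1) x(3) by simp
    then have b: "t\<^sup>2 + D * k\<^sup>2 \<le> 36"
      by linarith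
    have b3: "t\<^sup>2 + 3 * k\<^sup>2 \<le> 36"
      using b mult_right_mono[OF D(1), of "k\<^sup>2"] by simp
    have ok: "ok (t, k)"
    proof (cases "D mod 4 = 3")
      case True
      with par b3 half show ?thesis
        by (simp add: ok_def)
    next
      case False
      then have D0: "D mod 4 = 0"
        using D by simp
      then have "4 \<le> D"
        using D(1) by presburger
      then have "t\<^sup>2 + 4 * k\<^sup>2 \<le> 36"
        using b mult_right_mono[of 4 D "k\<^sup>2"] by simp
      with False D0 par half show ?thesis
        by (simp add: ok_def)
    qed
    have "t\<^sup>2 \<le> 36"
      using b3 zero_le_power2[of k] by linarith
    then have "t\<^sup>2 \<le> 6\<^sup>2"
      by simp
    then have "\<bar>t\<bar> \<le> 6"
      by (metis abs_le_square_iff abs_numeral)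
    moreover have "k\<^sup>2 \<le> 12"
      using b3 zero_le_power2[of t] by linarith
    then have "k\<^sup>2 < 4\<^sup>2"
      by simp
    then have "\<bar>k\<bar> < 4"
      using abs_le_square_iff[of 4 k] by (simp flip: not_le)
    ultimately have "t = -6 \<or> t = -5 \<or> t = -4 \<or> t = -3 \<or> t = -2 \<or> t = -1 \<or> t = 0 \<or>
        t = 1 \<or> t = 2 \<or> t = 3 \<or> t = 4 \<or> t = 5 \<or> t = 6"
      and "k = 0 \<or> k = 1 \<or> k = 2 \<or> k = 3"
      using half by presburger+
    then have "(t, k) \<in> set xs"
      using ok
      by (simp only: xs_def set_filter set_product set_simps insert_iff empty_iff mem_Collect_eq
            mem_Times_iff fst_conv snd_conv simp_thms)
    moreover have "x = Complex (of_int t / 2) (of_int k * h)"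
      using t k by (simp add: complex_eq_iff)
    ultimately show "s \<in> F ` set xs"
      using x(1) by (force simp: F_def)
  qed
  moreover have "card (F ` set xs) \<le> 19"
  proof -
    have "length xs \<le> 19"
      using lattice_points_in_half_disc
      by (cases "D mod 4 = 3") (simp_all only: xs_def ok_def if_True if_False simp_thms)
    then show ?thesis
      by (meson List.finite_set card_image_le card_length order_trans)
  qed
  ultimately show "finite S" "card S \<le> 19"
    by (auto intro: finite_subset order_trans[OF card_mono])
qed

text \<open>Fix one small element \<open>a\<close>. Every other small element \<open>b\<close> is determined by the square \<open>a b - 1\<close>, whose
absolute value is at most 9 because norms below 9 are at most 8.\<close>

lemma card_small_diophantine_le_20:
  assumes A: "A \<subseteq> R - {0}" and fin: "finite A"
    and sq: "\<And>a b. a \<in> A \<Longrightarrow> b \<in> A \<Longrightarrow> a \<noteq> b \<Longrightarrow> \<exists>x\<in>R. a * b - 1 = x\<^sup>2"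
  shows "card {a \<in> A. cmod a < 3} \<le> 20"
proof (cases "{a \<in> A. cmod a < 3} = {}")
  case False
  then obtain a where a: "a \<in> A" "cmod a < 3"
    by auto
  have le8: "(cmod b)\<^sup>2 \<le> 8" if b: "b \<in> A" "cmod b < 3" for b
  proof -
    obtain n where n: "(cmod b)\<^sup>2 = of_int n"
      using norm_int[of b] A b by (metis Diff_iff Ints_cases subsetD)
    have "(cmod b)\<^sup>2 < 3\<^sup>2"
      using b by (intro power_strict_mono) auto
    then have "n < 9"
      unfolding n by simp
    then show ?thesis
      unfolding n by simp
  qed
  define S where "S = {x\<^sup>2 | x. x \<in> R \<and> (cmod x)\<^sup>2 \<le> 9}"
  define T where "T = {b \<in> A. cmod b < 3} - {a}"
  have "card T \<le> card S"
  proof (rule card_inj_on_le[where f = "\<lambda>b. a * b - 1"])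
    show "inj_on (\<lambda>b. a * b - 1) T"
    proof (rule inj_onI)
      fix b c assume "a * b - 1 = a * c - 1"
      moreover have "a \<noteq> 0"
        using a A by blast
      ultimately show "b = c"
        by simp
    qed
    show "(\<lambda>b. a * b - 1) ` T \<subseteq> S"
    proof (rule image_subsetI)
      fix b assume "b \<in> T"
      then have b: "b \<in> A" "cmod b < 3" "b \<noteq> a"
        by (auto simp: T_def)
      then obtain x where x: "x \<in> R" "a * b - 1 = x\<^sup>2"
        using sq[OF a(1) b(1)] by metis
      have "(cmod a)\<^sup>2 * (cmod b)\<^sup>2 \<le> 8 * 8"
        using le8[OF a] le8[OF b(1,2)] by (intro mult_mono) auto
      then have "(cmod (a * b))\<^sup>2 \<le> 8\<^sup>2"
        by (simp add: norm_mult power_mult_distrib)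
      then have "cmod (a * b) \<le> 8"
        by (rule power2_le_imp_le) simp
      then have "cmod (a * b - 1) \<le> 9"
        using norm_triangle_ineq4[of "a * b" 1] by simp
      then have "(cmod x)\<^sup>2 \<le> 9"
        by (simp add: x(2) norm_power)
      then show "a * b - 1 \<in> S"
        using x unfolding S_def by blast
    qed
    show "finite S"
      unfolding S_def by (rule card_squares_norm_le_9)
  qed
  also have "card S \<le> 19"
    unfolding S_def by (rule card_squares_norm_le_9)
  finally have "card T \<le> 19" .
  moreover have "finite T"
    using fin by (simp add: T_def)
  then have "card (insert a T) \<le> Suc (card T)"
    by (simp add: card_insert_if)
  moreover have "{a \<in> A. cmod a < 3} = insert a T"
    using a by (auto simp: T_def)
  ultimately show ?thesis
    by simp
next
  case True
  then show ?thesis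
    by (simp only: card.empty)
qed

end

section \<open>The gap principle\<close>

text \<open>The condition says that \<open>c = a + b + 2 r\<close> for one of the two square roots \<open>r\<close> of \<open>a b - 1\<close>. Its left side
minus its right side is the symmetric polynomial
\<open>a\<^sup>2 + b\<^sup>2 + c\<^sup>2 - 2 (a b + b c + c a) + 4\<close>.\<close>

definition regular_triple :: "complex \<Rightarrow> complex \<Rightarrow> complex \<Rightarrow> bool" where
  "regular_triple a b c \<longleftrightarrow> (c - a - b)\<^sup>2 = 4 * (a * b - 1)"

lemma regular_triple_square_root:
  assumes "regular_triple a b c" "a * b - 1 = r\<^sup>2"
  shows "c = a + b + 2 * r \<or> c = a + b - 2 * r"
proof -
  have "(c - a - b)\<^sup>2 = (2 * r)\<^sup>2"
    using assms by (simp add: regular_triple_def power_mult_distrib)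
  then have "c - a - b = 2 * r \<or> c - a - b = - (2 * r)"
    by (simp only: power2_eq_iff)
  then show ?thesis
    by (auto simp: algebra_simps)
qed

lemma regular_triple_norm_le:
  assumes reg: "regular_triple a b c" and le: "cmod a \<le> cmod b"
  shows "cmod c \<le> 4 * cmod b + 2"
proof -
  have "(cmod (c - a - b))\<^sup>2 = 4 * cmod (a * b - 1)"
    using reg unfolding regular_triple_def by (metis norm_mult norm_numeral norm_power)
  also have "\<dots> \<le> 4 * (cmod (a * b) + 1)"
    using norm_triangle_ineq4[of "a * b" 1] by simp
  also have "cmod (a * b) \<le> cmod b * cmod b"
    using le by (simp add: norm_mult mult_right_mono)
  also have "4 * (cmod b * cmod b + 1) \<le> (2 * cmod b + 2)\<^sup>2"
    by (simp add: power2_eq_square algebra_simps)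
  finally have "cmod (c - a - b) \<le> 2 * cmod b + 2"
    by (rule power2_le_imp_le) simp_all
  moreover have "c = (c - a - b) + a + b"
    by simp
  then have "cmod c \<le> cmod (c - a - b) + cmod a + cmod b"
    by (metis norm_triangle_ineq norm_triangle_mono order_refl)
  ultimately show ?thesis
    using le by linarith
qed

text \<open>For given \<open>k\<close> and \<open>l\<close> regularity of \<open>{e, k, l}\<close> is a quadratic equation for \<open>e\<close>. If \<open>a\<close> and \<open>b\<close> are its
two roots, then \<open>a + b = 2 (k + l)\<close> and \<open>a b = (k - l)\<^sup>2 + 4\<close>, and eliminating \<open>l\<close> gives
\<open>(2 k - (a + b) / 2)\<^sup>2 = a b - 4\<close>, which is impossible when \<open>k\<close> is large compared to \<open>a\<close> and \<open>b\<close>.\<close>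

lemma not_two_regular_triples:
  assumes "regular_triple a k l" "regular_triple b k l" "a \<noteq> b"
    and "cmod a \<le> cmod b" "1 \<le> cmod b" "6 * cmod b \<le> cmod k"
  shows False
proof -
  have "(a - b) * (a + b - 2 * (k + l)) = 0"
    using assms(1,2) by (simp add: regular_triple_def power2_eq_square) algebra
  then have sum: "a + b = 2 * (k + l)"
    using \<open>a \<noteq> b\<close> by simp
  have "(2 * k - (a + b) / 2)\<^sup>2 = a * b - 4"
    using assms(1) sum unfolding regular_triple_def power2_eq_square by algebra
  then have "(cmod (2 * k - (a + b) / 2))\<^sup>2 = cmod (a * b - 4)"
    by (simp flip: norm_power)
  also have "\<dots> \<le> cmod (a * b) + 4"
    using norm_triangle_ineq4[of "a * b" 4] by simp
  also have "cmod (a * b) \<le> cmod b * cmod b"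
    using assms by (simp add: norm_mult mult_right_mono)
  finally have 1: "(cmod (2 * k - (a + b) / 2))\<^sup>2 \<le> cmod b * cmod b + 4"
    by simp
  have "cmod (2 * k) - cmod ((a + b) / 2) \<le> cmod (2 * k - (a + b) / 2)"
    by (rule norm_triangle_ineq2)
  moreover have "cmod ((a + b) / 2) \<le> cmod b"
    using norm_triangle_ineq[of a b] assms by (simp add: norm_divide)
  ultimately have "11 * cmod b \<le> cmod (2 * k - (a + b) / 2)"
    using assms by (simp add: norm_mult)
  then have "(11 * cmod b)\<^sup>2 \<le> (cmod (2 * k - (a + b) / 2))\<^sup>2"
    by (intro power_mono) auto
  with 1 have "120 * (cmod b * cmod b) \<le> 4"
    by (simp add: power2_eq_square)
  moreover have "1 * 1 \<le> cmod b * cmod b"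
    using assms by (intro mult_mono) auto
  ultimately show False
    by simp
qed

text \<open>The inequality is quadratic in \<open>z\<close> with positive leading coefficient. It fails at \<open>z = y\<close> and at
\<open>z = 2 x y\<close>, hence in between.\<close>

lemma gap_arithmetic:
  fixes x y z :: real
  assumes "3 \<le> x" "x \<le> y" "y \<le> z"
    and *: "4 * (x * y * z) \<le> (x + y + z)\<^sup>2 + 2 * (x + y + z) + 5"
  shows "2 * x * y \<le> z"
proof (rule ccontr)
  assume "\<not> 2 * x * y \<le> z"
  then have "0 \<le> (z - y) * (2 * x * y - z)"
    using assms by (intro mult_nonneg_nonneg) auto
  then have z2: "z * z \<le> y * z + 2 * x * y * z - 2 * x * y * y"
    by (simp add: algebra_simps)
  have "0 \<le> (2 * x - 3) * (y - x)"
    using assms by (intro mult_nonneg_nonneg) auto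
  then have "2 * (x * x) + 3 * y \<le> 3 * x + 2 * x * y"
    by (simp add: algebra_simps)
  moreover have "3 * x \<le> x * x"
    using assms by (intro mult_right_mono) auto
  ultimately have pos: "0 \<le> 2 * x * y - 3 * y - 2 * x - 2"
    using assms by linarith
  have "y * (2 * x * y - 3 * y - 2 * x - 2) \<le> z * (2 * x * y - 3 * y - 2 * x - 2)"
    using assms pos by (intro mult_right_mono) auto
  with z2 * have "4 * x * (y * y) \<le> 4 * (y * y) + 4 * (x * y) + 4 * y + x * x + 2 * x + 5"
    by (simp add: power2_eq_square algebra_simps)
  moreover have "x * y \<le> y * y" "x * x \<le> y * y"
    using assms by (auto intro: mult_mono)
  moreover have "3 * (y * y) \<le> x * (y * y)"
    using assms by (intro mult_right_mono) auto
  moreover have "3 * y \<le> y * y"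
    using assms by (intro mult_right_mono) auto
  ultimately show False
    using assms by (simp add: algebra_simps)
qed

context quadratic_order
begin

text \<open>The numbers \<open>e, f = 2 a b c - (a + b + c) \<plusminus> 2 r s t\<close> lie in \<open>R\<close>, and their product is the polynomial
that vanishes on regular triples. When it does not vanish, both numbers have absolute value at least 1, so
the absolute value of their sum, which is about \<open>4 \<bar>a b c\<bar>\<close>, is at most \<open>\<bar>e f\<bar> + 1\<close>, which is of the order
of \<open>\<bar>c\<bar>\<^sup>2\<close>.\<close>

lemma gap_principle:
  assumes R: "a \<in> R" "b \<in> R" "c \<in> R"
    and sq: "r \<in> R" "a * b - 1 = r\<^sup>2" "s \<in> R" "a * c - 1 = s\<^sup>2" "t \<in> R" "b * c - 1 = t\<^sup>2"
    and nreg: "\<not> regular_triple a b c"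
    and le: "3 \<le> cmod a" "cmod a \<le> cmod b" "cmod b \<le> cmod c"
  shows "2 * cmod a * cmod b \<le> cmod c"
proof (rule gap_arithmetic[OF le])
  define e f where "e = 2 * a * b * c - (a + b + c) + 2 * r * s * t"
    and "f = 2 * a * b * c - (a + b + c) - 2 * r * s * t"
  have ef: "e \<in> R" "f \<in> R"
    unfolding e_def f_def using R sq
    by (auto intro!: add_mem diff_mem mult_mem numeral_mem)
  have "e * f = (2 * a * b * c - (a + b + c))\<^sup>2 - 4 * (r\<^sup>2 * s\<^sup>2 * t\<^sup>2)"
    by (simp add: e_def f_def power2_eq_square algebra_simps)
  also have "r\<^sup>2 * s\<^sup>2 * t\<^sup>2 = (a * b - 1) * (a * c - 1) * (b * c - 1)"
    using sq by simp
  also have "(2 * a * b * c - (a + b + c))\<^sup>2 - 4 * ((a * b - 1) * (a * c - 1) * (b * c - 1))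
      = (c - a - b)\<^sup>2 - 4 * (a * b - 1)"
    by (simp add: power2_eq_square algebra_simps)
  finally have prod: "e * f = (c - a - b)\<^sup>2 - 4 * (a * b - 1)" .
  then have "e * f \<noteq> 0"
    using nreg by (simp add: regular_triple_def)
  then have "1 \<le> cmod e" "1 \<le> cmod f"
    using ef by (auto intro: norm_ge_1)
  then have "0 \<le> (cmod e - 1) * (cmod f - 1)"
    by (intro mult_nonneg_nonneg) auto
  then have sum: "cmod e + cmod f \<le> cmod (e * f) + 1"
    by (simp add: norm_mult algebra_simps)
  have "cmod (e * f) = cmod ((a * a + b * b + c * c + 4) - (2 * (a * b) + 2 * (b * c) + 2 * (a * c)))"
    by (simp add: prod power2_eq_square algebra_simps)
  also have "\<dots> \<le> cmod (a * a + b * b + c * c + 4) + cmod (2 * (a * b) + 2 * (b * c) + 2 * (a * c))"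
    by (rule norm_triangle_ineq4)
  also have "cmod (a * a + b * b + c * c + 4) \<le> cmod (a * a) + cmod (b * b) + cmod (c * c) + cmod 4"
    by (intro norm_triangle_mono order_refl)
  also have "cmod (2 * (a * b) + 2 * (b * c) + 2 * (a * c))
      \<le> cmod (2 * (a * b)) + cmod (2 * (b * c)) + cmod (2 * (a * c))"
    by (intro norm_triangle_mono order_refl)
  finally have "cmod (e * f) \<le> (cmod a + cmod b + cmod c)\<^sup>2 + 4"
    by (simp add: norm_mult power2_eq_square algebra_simps)
  moreover have "cmod (4 * (a * b * c)) - cmod (2 * (a + b + c)) \<le> cmod (4 * (a * b * c) - 2 * (a + b + c))"
    by (rule norm_triangle_ineq2)
  moreover have "4 * (a * b * c) - 2 * (a + b + c) = e + f"
    by (simp add: e_def f_def)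
  moreover have "cmod (e + f) \<le> cmod e + cmod f"
    by (rule norm_triangle_ineq)
  moreover have "cmod (2 * (a + b + c)) \<le> 2 * (cmod a + cmod b + cmod c)"
    unfolding norm_mult norm_numeral by (intro mult_left_mono norm_triangle_mono order_refl) auto
  ultimately show "4 * (cmod a * cmod b * cmod c)
      \<le> (cmod a + cmod b + cmod c)\<^sup>2 + 2 * (cmod a + cmod b + cmod c) + 5"
    using sum by (simp add: norm_mult)
qed

end

locale diophantine_set = quadratic_order +
  fixes A :: "complex set"
  assumes subset: "A \<subseteq> R - {0}" and finite: "finite A"
    and squares: "a \<in> A \<Longrightarrow> b \<in> A \<Longrightarrow> a \<noteq> b \<Longrightarrow> \<exists>x\<in>R. a * b - 1 = x\<^sup>2"
begin

lemma mem_R: "a \<in> A \<Longrightarrow> a \<in> R"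
  using subset by auto

lemma gap:
  assumes "a \<in> A" "b \<in> A" "c \<in> A" "a \<noteq> b" "a \<noteq> c" "b \<noteq> c" "\<not> regular_triple a b c"
    "3 \<le> cmod a" "cmod a \<le> cmod b" "cmod b \<le> cmod c"
  shows "2 * cmod a * cmod b \<le> cmod c"
proof -
  obtain r s t where "r \<in> R" "a * b - 1 = r\<^sup>2" "s \<in> R" "a * c - 1 = s\<^sup>2" "t \<in> R" "b * c - 1 = t\<^sup>2"
    using squares[of a b] squares[of a c] squares[of b c] assms by auto
  then show ?thesis
    using gap_principle[of a b c r s t] assms mem_R by blast
qed

text \<open>One of the triples \<open>{a, k, l}\<close> and \<open>{b, k, l}\<close> is not regular, so \<open>\<bar>l\<bar> \<ge> 6 \<bar>k\<bar>\<close>. But the largest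
element of a regular triple is at most about 4 times the second largest, so no triple \<open>{j, k, l}\<close> with
\<open>\<bar>j\<bar> \<le> \<bar>k\<bar>\<close> is regular, and the gap principle applies to all of them.\<close>

lemma gap_above:
  assumes ab: "a \<in> A" "b \<in> A" "a \<noteq> b" "3 \<le> cmod a" "cmod a \<le> cmod b"
    and kl: "k \<in> A" "l \<in> A" "k \<noteq> l" "6 * cmod b \<le> cmod k" "cmod k \<le> cmod l"
    and j: "j \<in> A" "j \<noteq> k" "j \<noteq> l" "3 \<le> cmod j" "cmod j \<le> cmod k"
  shows "2 * cmod j * cmod k \<le> cmod l"
proof -
  have big: "6 * cmod k \<le> cmod l"
  proof -
    have step: "6 * cmod k \<le> cmod l" if "i \<in> A" "3 \<le> cmod i" "cmod i \<le> cmod b" "\<not> regular_triple i k l" for i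
    proof -
      have "i \<noteq> k" "i \<noteq> l" "cmod i \<le> cmod k"
        using that ab kl by auto
      then have "2 * cmod i * cmod k \<le> cmod l"
        using gap[of i k l] that kl by blast
      moreover have "3 * cmod k \<le> cmod i * cmod k"
        using that by (intro mult_right_mono) auto
      ultimately show ?thesis
        by simp
    qed
    show ?thesis
    proof (cases "regular_triple a k l")
      case True
      then have "\<not> regular_triple b k l"
        using not_two_regular_triples[of a k l b] ab kl by auto
      then show ?thesis
        using step[of b] ab by simp
    next
      case False
      then show ?thesis
        using step[of a] ab by simp
    qed
  qed
  have "\<not> regular_triple j k l"
  proof
    assume "regular_triple j k l"
    then have "cmod l \<le> 4 * cmod k + 2"
      using j by (intro regular_triple_norm_le)
    then show False
      using big ab kl by linarith
  qed
  then show ?thesis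
    using gap[of j k l] j kl by blast
qed

text \<open>Here \<open>a\<close> and \<open>b\<close> are the two smallest elements of absolute value at least 3. Discarding the at most two
regular extensions of this pair leaves at least 13 of the at least 15 others.\<close>

lemma fast_growing_sublist:
  assumes "17 \<le> card {a \<in> A. 3 \<le> cmod a}"
  obtains a b xs where "a \<in> A" "b \<in> A" "a \<noteq> b" "3 \<le> cmod a" "cmod a \<le> cmod b"
    "distinct xs" "set xs \<subseteq> A" "13 \<le> length xs" "sorted (map cmod xs)"
    "\<And>c. c \<in> set xs \<Longrightarrow> 2 * cmod a * cmod b \<le> cmod c"
proof -
  define L where "L = {a \<in> A. 3 \<le> cmod a}"
  have finL: "Finite_Set.finite L"
    using finite by (simp add: L_def)
  obtain ys0 where ys0: "set ys0 = L" "distinct ys0"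
    using finite_distinct_list[OF finL] by auto
  define ys where "ys = sort_key cmod ys0"
  have ys: "set ys = L" "distinct ys" "sorted (map cmod ys)"
    using ys0 by (simp_all add: ys_def)
  have len: "17 \<le> length ys"
    using assms distinct_card[OF ys(2)] ys(1) by (simp add: L_def)
  then obtain a b zs where split: "ys = a # b # zs"
    by (cases ys; cases "tl ys") auto
  have zs: "15 \<le> length zs" "distinct zs" "sorted (map cmod zs)" "a \<noteq> b" "a \<notin> set zs" "b \<notin> set zs"
    "cmod a \<le> cmod b" "\<And>c. c \<in> set zs \<Longrightarrow> cmod b \<le> cmod c"
    using len ys by (auto simp: split)
  have ab: "a \<in> L" "b \<in> L" "set zs \<subseteq> L"
    using ys(1) by (auto simp: split)
  then obtain r where r: "r \<in> R" "a * b - 1 = r\<^sup>2"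
    using squares[of a b] \<open>a \<noteq> b\<close> by (auto simp: L_def)
  define xs where "xs = filter (\<lambda>c. c \<noteq> a + b + 2 * r \<and> c \<noteq> a + b - 2 * r) zs"
  show ?thesis
  proof (rule that)
    show "13 \<le> length xs"
    proof -
      have "set zs \<subseteq> set xs \<union> {a + b + 2 * r, a + b - 2 * r}"
        by (auto simp: xs_def)
      then have "card (set zs) \<le> card (set xs \<union> {a + b + 2 * r, a + b - 2 * r})"
        by (intro card_mono) auto
      also have "\<dots> \<le> card (set xs) + card {a + b + 2 * r, a + b - 2 * r}"
        by (rule card_Un_le)
      also have "card {a + b + 2 * r, a + b - 2 * r} \<le> 2"
        by (simp add: card_insert_if)
      finally have "card (set zs) \<le> card (set xs) + 2"
        by simp
      then show ?thesis
        using zs(1) distinct_card[OF zs(2)] distinct_card[of xs] zs(2) by (simp add: xs_def)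
    qed
    show "sorted (map cmod xs)"
      unfolding xs_def using zs(3) by (rule sorted_filter)
    fix c assume c: "c \<in> set xs"
    then have "\<not> regular_triple a b c"
      using regular_triple_square_root[OF _ r(2)] by (auto simp: xs_def)
    moreover have "c \<in> A" "cmod b \<le> cmod c" "a \<noteq> c" "b \<noteq> c"
      using c zs ab by (auto simp: xs_def L_def)
    ultimately show "2 * cmod a * cmod b \<le> cmod c"
      using gap[of a b c] ab zs by (auto simp: L_def)
  qed (use zs ab in \<open>auto simp: xs_def L_def\<close>)
qed

text \<open>By the gap lemma the numbers \<open>y i\<close>, twice the absolute values of the list elements, satisfy
\<open>y i y (i + 1) \<le> y (i + 2)\<close>, so that their logarithms grow at least like Fibonacci numbers: the exponents
34 and 8 below are two of them.\<close>

lemma fast_growing_quadruple: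
  assumes "17 \<le> card {a \<in> A. 3 \<le> cmod a}"
  obtains a b c d where "a \<in> A" "b \<in> A" "c \<in> A" "d \<in> A" "a \<noteq> b" "3 \<le> cmod a" "cmod a \<le> cmod b"
    "6 ^ 21 * (2 * cmod b) ^ 34 \<le> 2 * cmod c" "(2 * cmod c) ^ 8 \<le> 2 * cmod d"
proof -
  obtain a b xs where ab: "a \<in> A" "b \<in> A" "a \<noteq> b" "3 \<le> cmod a" "cmod a \<le> cmod b"
    and xs: "distinct xs" "set xs \<subseteq> A" "13 \<le> length xs" "sorted (map cmod xs)"
    and big: "\<And>c. c \<in> set xs \<Longrightarrow> 2 * cmod a * cmod b \<le> cmod c"
    using fast_growing_sublist[OF assms] by blast
  define y where "y i = 2 * cmod (xs ! i)" for i
  define w where "w = 2 * cmod b"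
  have w6: "6 \<le> w"
    using ab by (simp add: w_def)
  have mem: "xs ! i \<in> set xs" if "i < 13" for i
    using that xs by auto
  have six: "6 * cmod b \<le> cmod (xs ! i)" if "i < 13" for i
  proof -
    have "3 * cmod b \<le> cmod a * cmod b"
      using ab by (intro mult_right_mono) auto
    with big[OF mem[OF that]] show ?thesis
      by simp
  qed
  have mono: "cmod (xs ! i) \<le> cmod (xs ! j)" if "i \<le> j" "j < 13" for i j
    using sorted_nth_mono[OF xs(4), of i j] that xs by simp
  have ne: "xs ! i \<noteq> xs ! j" if "i < j" "j < 13" for i j
    using that xs by (simp add: nth_eq_iff_index_eq)
  have pos: "1 \<le> y i" if "i < 13" for i
    using six[OF that] ab by (simp add: y_def)
  have y0: "6 * w \<le> y 0"
    using six[of 0] by (simp add: y_def w_def)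
  have y1: "w * y 0 \<le> y 1"
  proof -
    have "2 * cmod b * cmod (xs ! 0) \<le> cmod (xs ! 1)"
      using six[of 0] six[of 1] ab mem[of 0] mem[of 1] xs mono[of 0 1] ne[of 0 1]
      by (intro gap_above[of a b]) auto
    then show ?thesis
      by (simp add: y_def w_def)
  qed
  have y2: "y i * y (Suc i) \<le> y (Suc (Suc i))" if "i < 11" for i
  proof -
    have "2 * cmod (xs ! i) * cmod (xs ! Suc i) \<le> cmod (xs ! Suc (Suc i))"
      using six[of i] six[of "Suc i"] ab mem[of i] mem[of "Suc i"] mem[of "Suc (Suc i)"] xs that
        mono[of i "Suc i"] mono[of "Suc i" "Suc (Suc i)"]
        ne[of i "Suc i"] ne[of "Suc i" "Suc (Suc i)"] ne[of i "Suc (Suc i)"]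
      by (intro gap_above[of a b]) auto
    then show ?thesis
      by (simp add: y_def)
  qed
  have mult: "u * v \<le> y (Suc (Suc i))" if "u \<le> y i" "v \<le> y (Suc i)" "0 \<le> u" "0 \<le> v" "i < 11" for u v i
    using mult_mono[OF that(1,2)] y2[OF that(5)] that pos[of i] by auto
  have Y1: "6 * w ^ 2 \<le> y 1"
  proof -
    have "w * (6 * w) \<le> w * y 0"
      using y0 w6 by (intro mult_left_mono) auto
    then have "6 * (w * w) \<le> w * y 0"
      by (simp only: mult.left_commute)
    with y1 show ?thesis
      unfolding power2_eq_square by linarith
  qed
  have Y2: "6 ^ 2 * w ^ 3 \<le> y 2"
    using mult[OF y0 Y1[unfolded One_nat_def]] w6 by (simp add: eval_nat_numeral mult_ac)
  have Y3: "6 ^ 3 * w ^ 5 \<le> y 3"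
    using mult[of "6 * w ^ 2" 1 "6 ^ 2 * w ^ 3"] Y1 Y2 w6 by (simp add: eval_nat_numeral mult_ac)
  have Y4: "6 ^ 5 * w ^ 8 \<le> y 4"
    using mult[of "6 ^ 2 * w ^ 3" 2 "6 ^ 3 * w ^ 5"] Y2 Y3 w6 by (simp add: eval_nat_numeral mult_ac)
  have Y5: "6 ^ 8 * w ^ 13 \<le> y 5"
    using mult[of "6 ^ 3 * w ^ 5" 3 "6 ^ 5 * w ^ 8"] Y3 Y4 w6 by (simp add: eval_nat_numeral mult_ac)
  have Y6: "6 ^ 13 * w ^ 21 \<le> y 6"
    using mult[of "6 ^ 5 * w ^ 8" 4 "6 ^ 8 * w ^ 13"] Y4 Y5 w6 by (simp add: eval_nat_numeral mult_ac)
  have Y7: "6 ^ 21 * w ^ 34 \<le> y 7"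
    using mult[of "6 ^ 8 * w ^ 13" 5 "6 ^ 13 * w ^ 21"] Y5 Y6 w6 by (simp add: eval_nat_numeral mult_ac)
  have Z8: "y 7 \<le> y 8"
    using mult[of 1 6 "y 7"] pos[of 6] pos[of 7] by simp
  have Z9: "y 7 ^ 2 \<le> y 9"
    using mult[of "y 7" 7 "y 7"] Z8 pos[of 7] by (simp add: eval_nat_numeral mult_ac)
  have Z10: "y 7 ^ 3 \<le> y 10"
    using mult[of "y 7" 8 "y 7 ^ 2"] Z8 Z9 pos[of 7] by (simp add: eval_nat_numeral mult_ac)
  have Z11: "y 7 ^ 5 \<le> y 11"
    using mult[of "y 7 ^ 2" 9 "y 7 ^ 3"] Z9 Z10 pos[of 7] by (simp add: eval_nat_numeral mult_ac)
  have Z12: "y 7 ^ 8 \<le> y 12"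
    using mult[of "y 7 ^ 3" 10 "y 7 ^ 5"] Z10 Z11 pos[of 7] by (simp add: eval_nat_numeral mult_ac)
  show ?thesis
    using that[of a b "xs ! 7" "xs ! 12"] ab xs(2) mem[of 7] mem[of 12] Y7 Z12
    by (auto simp: y_def w_def)
qed

end

section \<open>Divided differences and Hermite interpolation at three nodes\<close>

definition taylor_coeff :: "complex poly \<Rightarrow> complex \<Rightarrow> nat \<Rightarrow> complex" where
  "taylor_coeff G z h = coeff (G \<circ>\<^sub>p [:z, 1:]) h"

definition lin :: "complex \<Rightarrow> complex poly" where
  "lin z = [:-z, 1:]"

lemma lin_nonzero [simp]: "lin z \<noteq> 0"
  by (simp add: lin_def)

lemma degree_lin [simp]: "degree (lin z) = 1"
  by (simp add: lin_def)

lemma degree_lin_power [simp]: "degree (lin z ^ n) = n"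
  by (simp add: lin_def degree_linear_power)

lemma lin_times: "lin z * G = pCons 0 G - smult z G"
  by (simp add: lin_def)

text \<open>Let \<open>N\<close> be a monic polynomial whose roots are the interpolation nodes. Then \<open>G mod N\<close> is the Hermite
interpolant of \<open>G\<close> at the nodes, and its coefficient of degree \<open>degree N - 1\<close> is the divided difference of
\<open>G\<close>. The next lemmas are the rules of calculation for divided differences in this language.\<close>

definition top_coeff_mod :: "complex poly \<Rightarrow> complex poly \<Rightarrow> complex" where
  "top_coeff_mod N G = coeff (G mod N) (degree N - 1)"

lemma top_coeff_mod_linear_factor:
  assumes "N \<noteq> 0"
  shows "top_coeff_mod (lin z * N) (lin z * G) = top_coeff_mod N G"
proof -
  have deg: "degree (lin z * N) = Suc (degree N)"
    using assms by (subst degree_mult_eq) auto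
  have "(lin z * G) mod (lin z * N) = lin z * (G mod N)"
    by (rule mod_mult_mult1)
  then have *: "top_coeff_mod (lin z * N) (lin z * G)
      = coeff (pCons 0 (G mod N)) (degree N) - z * coeff (G mod N) (degree N)"
    unfolding top_coeff_mod_def deg by (simp add: lin_times)
  show ?thesis
  proof (cases "degree N")
    case 0
    then have "G mod N = 0"
      using degree_mod_less[OF assms, of G] by auto
    then show ?thesis
      unfolding * by (simp add: top_coeff_mod_def)
  next
    case (Suc n)
    then have "coeff (G mod N) (degree N) = 0"
      using degree_mod_less[OF assms, of G] by (auto intro: coeff_eq_0)
    then show ?thesis
      unfolding * by (simp add: top_coeff_mod_def Suc)
  qed
qed

lemma top_coeff_mod_add: "top_coeff_mod N (F + G) = top_coeff_mod N F + top_coeff_mod N G"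
  by (simp add: top_coeff_mod_def poly_mod_add_left)

lemma top_coeff_mod_diff: "top_coeff_mod N (F - G) = top_coeff_mod N F - top_coeff_mod N G"
  by (simp add: top_coeff_mod_def poly_mod_diff_left)

lemma top_coeff_mod_smult: "top_coeff_mod N (smult c G) = c * top_coeff_mod N G"
  by (simp add: top_coeff_mod_def mod_smult_left)

lemma top_coeff_mod_low_degree:
  assumes "degree G < degree N"
  shows "top_coeff_mod N G = coeff G (degree N - 1)"
  using assms by (simp add: top_coeff_mod_def mod_poly_less)

lemma top_coeff_mod_two_factors:
  assumes "N \<noteq> 0"
  shows "(z - w) * top_coeff_mod (lin z * lin w * N) G
    = top_coeff_mod (lin z * N) G - top_coeff_mod (lin w * N) G"
proof -
  have "smult (z - w) G = lin w * G - lin z * G"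
    by (simp add: lin_times smult_diff_left)
  then have "(z - w) * top_coeff_mod (lin z * lin w * N) G
      = top_coeff_mod (lin w * (lin z * N)) (lin w * G)
        - top_coeff_mod (lin z * (lin w * N)) (lin z * G)"
    by (metis top_coeff_mod_smult top_coeff_mod_diff mult.assoc mult.left_commute)
  also have "\<dots> = top_coeff_mod (lin z * N) G - top_coeff_mod (lin w * N) G"
    using assms by (subst (1 2) top_coeff_mod_linear_factor) auto
  finally show ?thesis .
qed

lemma pcompose_linear_power: "(lin z ^ n) \<circ>\<^sub>p [:z, 1:] = [:0, 1::complex:] ^ n"
proof (induction n)
  case (Suc n)
  have "lin z \<circ>\<^sub>p [:z, 1:] = [:0, 1:]"
    by (simp add: lin_def pcompose_pCons)
  then show ?case
    by (simp only: power_Suc pcompose_mult Suc)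
qed (simp add: pcompose_1)

lemma top_coeff_mod_single: "top_coeff_mod (lin z ^ Suc n) G = taylor_coeff G z n"
proof -
  define N where "N = lin z ^ Suc n"
  define M where "M = G mod N"
  have degN: "degree N = Suc n"
    unfolding N_def by (rule degree_lin_power)
  have N0: "N \<noteq> 0"
    using degN by auto
  have degM: "degree M \<le> n"
    using degree_mod_less[OF N0, of G] degN by (auto simp: M_def)
  have "G = N * (G div N) + M"
    by (simp add: M_def)
  then have "G \<circ>\<^sub>p [:z, 1:] = N \<circ>\<^sub>p [:z, 1:] * ((G div N) \<circ>\<^sub>p [:z, 1:]) + M \<circ>\<^sub>p [:z, 1:]"
    by (metis pcompose_add pcompose_mult)
  moreover have "N \<circ>\<^sub>p [:z, 1:] = monom 1 (Suc n)"
    by (simp only: N_def pcompose_linear_power monom_altdef smult_1_left)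
  ultimately have "G \<circ>\<^sub>p [:z, 1:] = monom 1 (Suc n) * ((G div N) \<circ>\<^sub>p [:z, 1:]) + M \<circ>\<^sub>p [:z, 1:]"
    by simp
  then have "taylor_coeff G z n = coeff (M \<circ>\<^sub>p [:z, 1:]) n"
    by (simp add: taylor_coeff_def coeff_monom_mult)
  also have "\<dots> = coeff M n"
  proof (cases "degree M = n")
    case True
    have "lead_coeff (M \<circ>\<^sub>p [:z, 1:]) = lead_coeff M * lead_coeff [:z, 1:] ^ degree M"
      by (rule lead_coeff_comp) simp
    with True show ?thesis
      by (simp add: degree_pcompose)
  next
    case False
    with degM have "degree M < n"
      by simp
    then show ?thesis
      by (simp add: coeff_eq_0 degree_pcompose)
  qed
  finally show ?thesis
    unfolding top_coeff_mod_def using degN by (simp add: M_def N_def)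
qed

text \<open>Divisibility by a power of a linear factor is vanishing of Taylor coefficients, so congruence modulo such a
power is agreement of Taylor coefficients. This turns the Chinese remainder theorem into Hermite
interpolation.\<close>

lemma power_dvd_iff_taylor_coeff:
  "lin z ^ n dvd G \<longleftrightarrow> (\<forall>h<n. taylor_coeff G z h = 0)"
proof
  assume "lin z ^ n dvd G"
  then obtain Q where "G = lin z ^ n * Q"
    by (elim dvdE)
  then have "G \<circ>\<^sub>p [:z, 1:] = monom 1 n * (Q \<circ>\<^sub>p [:z, 1:])"
    by (simp add: pcompose_mult pcompose_linear_power monom_altdef)
  then show "\<forall>h<n. taylor_coeff G z h = 0"
    by (simp add: taylor_coeff_def coeff_monom_mult)
next
  assume *: "\<forall>h<n. taylor_coeff G z h = 0"
  then have "monom 1 n dvd G \<circ>\<^sub>p [:z, 1:]"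
    by (simp add: taylor_coeff_def monom_1_dvd_iff')
  then obtain Q where Q: "G \<circ>\<^sub>p [:z, 1:] = monom 1 n * Q"
    by (elim dvdE)
  have "G = (G \<circ>\<^sub>p [:z, 1:]) \<circ>\<^sub>p lin z"
    by (simp add: pcompose_assoc[symmetric] pcompose_pCons lin_def)
  also have "\<dots> = lin z ^ n * (Q \<circ>\<^sub>p lin z)"
  proof -
    have "monom 1 n \<circ>\<^sub>p lin z = lin z ^ n"
      by (induction n) (simp_all add: monom_Suc pcompose_pCons pcompose_1)
    then show ?thesis
      unfolding Q by (simp add: pcompose_mult)
  qed
  finally show "lin z ^ n dvd G"
    by (metis dvd_triv_left)
qed

lemma taylor_coeff_diff: "taylor_coeff (F - G) z h = taylor_coeff F z h - taylor_coeff G z h"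
  by (simp add: taylor_coeff_def pcompose_diff)

lemma coprime_linear_powers:
  fixes z w :: complex
  assumes "z \<noteq> w"
  shows "coprime (lin z ^ m) (lin w ^ n)"
proof -
  have "coprime (lin z) (lin w)"
  proof (rule coprimeI)
    fix c assume "c dvd lin z" "c dvd lin w"
    then have "c dvd lin z - lin w"
      by (rule dvd_diff)
    then have "c dvd [:w - z:]"
      by (simp add: lin_def)
    moreover have "is_unit [:w - z:]"
      using assms by (simp add: is_unit_const_poly_iff dvd_field_iff)
    ultimately show "is_unit c"
      by (rule dvd_trans)
  qed
  then show ?thesis
    by simp
qed

lemma chinese_remainder_poly:
  fixes P Q F G :: "complex poly"
  assumes "coprime P Q"
  obtains H where "P dvd H - F" "Q dvd H - G"
proof -
  obtain x y where xy: "x * P + y * Q = 1"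
    using bezout_coefficients_fst_snd[of P Q] assms by (auto simp: coprime_iff_gcd_eq_1)
  define H where "H = F + x * P * (G - F)"
  have "H - G = (x * P - 1) * (G - F)"
    by (simp add: H_def algebra_simps)
  also have "x * P - 1 = - (y * Q)"
    using xy by (simp add: algebra_simps eq_diff_eq)
  finally have "Q dvd H - G"
    by simp
  moreover have "P dvd H - F"
    by (simp add: H_def)
  ultimately show ?thesis
    by (rule that[rotated])
qed

locale three_nodes =
  fixes u v w :: complex
  assumes distinct: "u \<noteq> v" "u \<noteq> w" "v \<noteq> w"
begin

definition node :: "nat \<Rightarrow> complex" where
  "node i = (if i = 0 then u else if i = 1 then v else w)"

lemma node_simps [simp]: "node 0 = u" "node (Suc 0) = v" "node 2 = w"
  by (simp_all add: node_def)

text \<open>The divided difference of arbitrary data with multiplicities \<open>p\<close>, \<open>q\<close>, \<open>r\<close> at \<open>u\<close>, \<open>v\<close>, \<open>w\<close>; here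
\<open>g i h\<close> is the prescribed Taylor coefficient of order \<open>h\<close> at the node with index \<open>i\<close>. The data need not come
from one function, which is what the application requires: there they come from three different multiples
of a power series. The recursion separates \<open>v\<close> from \<open>w\<close> first; the order does not matter for the value, but
it makes the denominators visible.\<close>

fun divided_difference :: "(nat \<Rightarrow> nat \<Rightarrow> complex) \<Rightarrow> nat \<Rightarrow> nat \<Rightarrow> nat \<Rightarrow> complex" where
  "divided_difference g p (Suc q) (Suc r) =
     (divided_difference g p (Suc q) r - divided_difference g p q (Suc r)) / (v - w)"
| "divided_difference g (Suc p) (Suc q) 0 =
     (divided_difference g (Suc p) q 0 - divided_difference g p (Suc q) 0) / (u - v)"
| "divided_difference g (Suc p) 0 (Suc r) =
     (divided_difference g (Suc p) 0 r - divided_difference g p 0 (Suc r)) / (u - w)"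
| "divided_difference g (Suc p) 0 0 = g 0 p"
| "divided_difference g 0 (Suc q) 0 = g 1 q"
| "divided_difference g 0 0 (Suc r) = g 2 r"
| "divided_difference g 0 0 0 = 0"

definition node_poly :: "nat \<Rightarrow> nat \<Rightarrow> nat \<Rightarrow> complex poly" where
  "node_poly p q r = lin u ^ p * lin v ^ q * lin w ^ r"

lemma node_poly_nonzero: "node_poly p q r \<noteq> 0"
  by (simp add: node_poly_def)

lemma degree_node_poly: "degree (node_poly p q r) = p + q + r"
  by (simp add: node_poly_def degree_mult_eq degree_linear_power)

lemma divided_difference_poly:
  assumes "\<And>i h. i < 3 \<Longrightarrow> h < max p (max q r) \<Longrightarrow> g i h = taylor_coeff G (node i) h"
  shows "divided_difference g p q r = top_coeff_mod (node_poly p q r) G"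
  using assms
proof (induction g p q r rule: divided_difference.induct)
  case (1 g p q r)
  have "node_poly p (Suc q) (Suc r) = lin v * lin w * node_poly p q r"
    "node_poly p (Suc q) r = lin v * node_poly p q r"
    "node_poly p q (Suc r) = lin w * node_poly p q r"
    by (simp_all only: node_poly_def power_Suc mult_ac)
  then show ?case
    using 1 top_coeff_mod_two_factors[OF node_poly_nonzero, of v w p q r G] distinct
    by (simp add: field_simps)
next
  case (2 g p q)
  have "node_poly (Suc p) (Suc q) 0 = lin u * lin v * node_poly p q 0"
    "node_poly (Suc p) q 0 = lin u * node_poly p q 0"
    "node_poly p (Suc q) 0 = lin v * node_poly p q 0"
    by (simp_all only: node_poly_def power_Suc mult_ac)
  then show ?case
    using 2 top_coeff_mod_two_factors[OF node_poly_nonzero, of u v p q 0 G] distinct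
    by (simp add: field_simps)
next
  case (3 g p r)
  have "node_poly (Suc p) 0 (Suc r) = lin u * lin w * node_poly p 0 r"
    "node_poly (Suc p) 0 r = lin u * node_poly p 0 r"
    "node_poly p 0 (Suc r) = lin w * node_poly p 0 r"
    by (simp_all only: node_poly_def power_Suc mult_ac)
  then show ?case
    using 3 top_coeff_mod_two_factors[OF node_poly_nonzero, of u w p 0 r G] distinct
    by (simp add: field_simps)
next
  case (4 g p)
  then show ?case
    using top_coeff_mod_single[of u p G] by (simp add: node_poly_def)
next
  case (5 g q)
  then show ?case
    using top_coeff_mod_single[of v q G] by (simp add: node_poly_def)
next
  case (6 g r)
  then show ?case
    using top_coeff_mod_single[of w r G] by (simp add: node_poly_def)
next
  case (7 g)
  then show ?case
    by (simp add: node_poly_def top_coeff_mod_def)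
qed

lemma divided_difference_add:
  "divided_difference (\<lambda>i h. f i h + g i h) p q r = divided_difference f p q r + divided_difference g p q r"
  by (induction f p q r rule: divided_difference.induct)
     (simp_all only: divided_difference.simps add_diff_add add_divide_distrib add_0_left)

lemma divided_difference_scale:
  "divided_difference (\<lambda>i h. c * g i h) p q r = c * divided_difference g p q r"
  by (induction g p q r rule: divided_difference.induct) (simp_all add: diff_divide_distrib algebra_simps)

lemma divided_difference_sums:
  assumes "\<And>i h. i < 3 \<Longrightarrow> (\<lambda>m. F m i h) sums g i h"
  shows "(\<lambda>m. divided_difference (F m) p q r) sums divided_difference g p q r"
  using assms
  by (induction g p q r rule: divided_difference.induct) (auto intro!: sums_divide sums_diff)

text \<open>Writing \<open>X = (X - z) + z\<close> for a node \<open>z\<close> gives a recursion of Pascal type for the divided differences of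
the powers of \<open>X\<close>. With nodes of absolute value at most \<open>1/3\<close>, the bound is preserved because
\<open>2/3 + 1/3 = 1\<close>.\<close>

lemma top_coeff_mod_monom_bound:
  assumes small: "cmod u \<le> 1 / 3" "cmod v \<le> 1 / 3" "cmod w \<le> 1 / 3"
  shows "cmod (top_coeff_mod (node_poly p q r) (monom 1 m)) \<le> (3 / 2) ^ (p + q + r - 1)"
proof (induction m arbitrary: p q r)
  case 0
  show ?case
  proof (cases "p + q + r = 0")
    case True
    then show ?thesis
      by (simp add: node_poly_def top_coeff_mod_def)
  next
    case False
    then have "top_coeff_mod (node_poly p q r) (monom 1 0) = coeff (monom 1 0) (p + q + r - 1)"
      by (subst top_coeff_mod_low_degree) (simp_all add: degree_node_poly degree_monom_eq)
    also have "cmod \<dots> \<le> 1"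
      by (simp add: coeff_monom)
    also have "1 \<le> (3 / 2 :: real) ^ (p + q + r - 1)"
      by (rule one_le_power) simp
    finally show ?thesis .
  qed
next
  case (Suc m)
  have step: "cmod (top_coeff_mod (lin z * N) (monom 1 (Suc m))) \<le> (3 / 2) ^ n"
    if z: "cmod z \<le> 1 / 3" and N: "N \<noteq> 0" "degree N = n"
      and b1: "cmod (top_coeff_mod (lin z * N) (monom 1 m)) \<le> (3 / 2) ^ n"
      and b2: "cmod (top_coeff_mod N (monom 1 m)) \<le> (3 / 2) ^ (n - 1)" for z N n
  proof -
    have "monom 1 (Suc m) = lin z * monom 1 m + smult z (monom 1 m)"
      by (simp add: monom_Suc lin_times)
    then have e: "top_coeff_mod (lin z * N) (monom 1 (Suc m))
        = top_coeff_mod N (monom 1 m) + z * top_coeff_mod (lin z * N) (monom 1 m)"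
      by (simp only: top_coeff_mod_add top_coeff_mod_smult top_coeff_mod_linear_factor[OF N(1)])
    show ?thesis
    proof (cases n)
      case 0
      then have "top_coeff_mod N (monom 1 m) = 0"
        using degree_mod_less[OF N(1), of "monom 1 m"] N(2) by (simp add: top_coeff_mod_def)
      then have "cmod (top_coeff_mod (lin z * N) (monom 1 (Suc m)))
          = cmod z * cmod (top_coeff_mod (lin z * N) (monom 1 m))"
        by (simp add: e norm_mult)
      also have "\<dots> \<le> 1 * 1"
        using z b1 0 by (intro mult_mono) auto
      finally show ?thesis
        by (simp add: 0)
    next
      case (Suc n')
      have "cmod (top_coeff_mod (lin z * N) (monom 1 (Suc m)))
          \<le> cmod (top_coeff_mod N (monom 1 m)) + cmod z * cmod (top_coeff_mod (lin z * N) (monom 1 m))"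
        unfolding e by (metis norm_mult norm_triangle_ineq)
      also have "\<dots> \<le> (3 / 2) ^ n' + 1 / 3 * (3 / 2) ^ n"
        using z b1 b2 Suc by (intro add_mono mult_mono) auto
      also have "\<dots> = (3 / 2) ^ n"
        by (simp add: Suc)
      finally show ?thesis .
    qed
  qed
  show ?case
  proof (cases p)
    case (Suc p')
    have "node_poly p q r = lin u * node_poly p' q r"
      by (simp only: node_poly_def power_Suc mult_ac Suc)
    then show ?thesis
      using step[of u "node_poly p' q r" "p' + q + r"] Suc.IH[of p q r] Suc.IH[of p' q r] small Suc
      by (simp add: node_poly_nonzero degree_node_poly)
  next
    case p0: 0
    show ?thesis
    proof (cases q)
      case (Suc q')
      have "node_poly p q r = lin v * node_poly p q' r"
        by (simp only: node_poly_def power_Suc mult_ac Suc)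
      then show ?thesis
        using step[of v "node_poly p q' r" "p + q' + r"] Suc.IH[of p q r] Suc.IH[of p q' r] small Suc
        by (simp add: node_poly_nonzero degree_node_poly)
    next
      case q0: 0
      show ?thesis
      proof (cases r)
        case (Suc r')
        have "node_poly p q r = lin w * node_poly p q r'"
          by (simp only: node_poly_def power_Suc mult_ac Suc)
        then show ?thesis
          using step[of w "node_poly p q r'" "p + q + r'"] Suc.IH[of p q r] Suc.IH[of p q r'] small Suc
          by (simp add: node_poly_nonzero degree_node_poly)
      next
        case 0
        then show ?thesis
          using p0 q0 by (simp add: node_poly_def top_coeff_mod_def)
      qed
    qed
  qed
qed

lemma hermite_interpolation:
  assumes n: "0 < n"
  obtains H where "degree H < 3 * n" "\<And>i h. i < 3 \<Longrightarrow> h < n \<Longrightarrow> taylor_coeff H (node i) h = g i h"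
proof -
  define L where "L i = (\<Sum>h<n. smult (g i h) (lin (node i) ^ h))" for i
  have L: "taylor_coeff (L i) (node i) h = g i h" if "h < n" for i h
  proof -
    have "L i \<circ>\<^sub>p [:node i, 1:] = (\<Sum>j<n. smult (g i j) (monom 1 j))"
      by (simp add: L_def pcompose_sum pcompose_smult pcompose_linear_power monom_altdef)
    then show ?thesis
      using that by (simp add: taylor_coeff_def coeff_sum coeff_monom if_distrib sum.delta cong: if_cong)
  qed
  define P where "P i = lin (node i) ^ n" for i
  have cop: "coprime (P 0) (P 1)" "coprime (P 0 * P 1) (P 2)"
    unfolding P_def node_simps coprime_mult_left_iff One_nat_def
    using distinct coprime_linear_powers by blast+
  obtain H1 where H1: "P 0 dvd H1 - L 0" "P 1 dvd H1 - L 1"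
    using chinese_remainder_poly[OF cop(1)] by blast
  obtain H2 where H2: "P 0 * P 1 dvd H2 - H1" "P 2 dvd H2 - L 2"
    using chinese_remainder_poly[OF cop(2)] by blast
  define N where "N = P 0 * P 1 * P 2"
  define H where "H = H2 mod N"
  have N: "N \<noteq> 0" "degree N = 3 * n"
    by (simp_all add: N_def P_def degree_mult_eq degree_linear_power)
  have "N dvd H - H2"
    unfolding H_def by (metis dvd_minus_mod dvd_minus_iff minus_diff_eq)
  then have d: "P i dvd H - H2" if "i < 3" for i
  proof -
    have "P 0 dvd N" "P 1 dvd N" "P 2 dvd N"
      unfolding N_def by (simp_all only: dvd_triv_right dvd_mult2 dvd_triv_left dvd_mult)
    moreover have "i = 0 \<or> i = 1 \<or> i = 2"
      using that by linarith
    ultimately have "P i dvd N"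
      by blast
    then show ?thesis
      using \<open>N dvd H - H2\<close> by (rule dvd_trans)
  qed
  have d2: "P i dvd H2 - L i" if "i < 3" for i
  proof -
    have a: "P 0 dvd H2 - H1" "P 1 dvd H2 - H1"
      using H2(1) by (blast dest: dvd_mult_left dvd_mult_right)+
    have "P 0 dvd (H2 - H1) + (H1 - L 0)" "P 1 dvd (H2 - H1) + (H1 - L 1)"
      using dvd_add[OF a(1) H1(1)] dvd_add[OF a(2) H1(2)] .
    then have "P 0 dvd H2 - L 0" "P 1 dvd H2 - L 1"
      by (simp_all only: diff_add_cancel add_diff_eq)
    moreover have "i = 0 \<or> i = 1 \<or> i = 2"
      using that by linarith
    ultimately show ?thesis
      using H2(2) by blast
  qed
  have dvd: "P i dvd H - L i" if "i < 3" for i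
    using dvd_add[OF d[OF that] d2[OF that]] by (simp only: diff_add_cancel add_diff_eq)
  have jets: "taylor_coeff H (node i) h = g i h" if "i < 3" "h < n" for i h
    using dvd[OF that(1)] L[OF that(2)] that(2)
    by (simp add: P_def power_dvd_iff_taylor_coeff taylor_coeff_diff)
  have "degree H < 3 * n"
  proof (cases "H = 0")
    case False
    then show ?thesis
      using degree_mod_less'[OF N(1), of H2] unfolding H_def N(2) by simp
  qed (use n in simp)
  with jets show thesis
    by (intro that)
qed

end

section \<open>Divided differences of binomial series\<close>

lemma gbinomial_Suc_times: "(a gchoose Suc m) * of_nat (Suc m) = (a gchoose m) * (a - of_nat m)"
  for a :: "'a :: field_char_0"
  using gbinomial_mult_1[of a m] by (simp add: algebra_simps)

lemma half_integer_gbinomial_bound: "cmod ((of_nat k + 1 / 2) gchoose m) \<le> 2 ^ k"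
proof (induction k arbitrary: m)
  case 0
  show ?case
  proof (induction m)
    case (Suc m)
    have "cmod ((1 / 2) gchoose Suc m) * real (Suc m) = cmod ((1 / 2) gchoose m) * cmod (1 / 2 - of_nat m)"
      using arg_cong[OF gbinomial_Suc_times[of "1 / 2 :: complex" m], of cmod]
      by (simp only: norm_mult norm_of_nat)
    also have "\<dots> \<le> 1 * real (Suc m)"
      using Suc norm_triangle_ineq4[of "1 / 2 :: complex" "of_nat m"] by (intro mult_mono) simp_all
    finally show ?case
      by (simp add: mult_le_cancel_right_pos del: of_nat_Suc)
  qed simp
next
  case (Suc k)
  show ?case
  proof (cases m)
    case (Suc m')
    have "(of_nat (Suc k) + 1 / 2 :: complex) gchoose m
        = ((of_nat k + 1 / 2) gchoose m') + ((of_nat k + 1 / 2) gchoose m)"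
      using gbinomial_Suc_Suc[of "of_nat k + 1 / 2 :: complex" m'] by (simp add: Suc add_ac)
    then have "cmod ((of_nat (Suc k) + 1 / 2) gchoose m)
        \<le> cmod ((of_nat k + 1 / 2) gchoose m') + cmod ((of_nat k + 1 / 2) gchoose m)"
      by (metis norm_triangle_ineq)
    also have "\<dots> \<le> 2 ^ k + 2 ^ k"
      by (intro add_mono Suc.IH)
    finally show ?thesis
      by simp
  next
    case 0
    have "(1 :: real) \<le> 2 ^ Suc k"
      by (rule one_le_power) simp
    with 0 show ?thesis
      by simp
  qed
qed

lemma minus_half_gbinomial: "4 ^ m * ((- 1 / 2 :: complex) gchoose m) = (- 1) ^ m * of_nat (2 * m choose m)"
proof (induction m)
  case (Suc m)
  have c: "of_nat (2 * Suc m choose Suc m) * of_nat (Suc m)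
      = (2 * (2 * of_nat m + 1) * of_nat (2 * m choose m) :: complex)"
  proof -
    have "of_nat (2 * Suc m choose Suc m) = (fact (2 * Suc m) / (fact (Suc m) * fact (Suc m)) :: complex)"
      using binomial_fact[of "Suc m" "2 * Suc m"] by simp
    moreover have "of_nat (2 * m choose m) = (fact (2 * m) / (fact m * fact m) :: complex)"
      using binomial_fact[of m "2 * m"] by simp
    moreover have "fact (2 * Suc m) = (of_nat (2 * Suc m) * (of_nat (Suc (2 * m)) * fact (2 * m)) :: complex)"
      by (simp only: fact_Suc mult_Suc_right add_Suc add_Suc_right One_nat_def add_2_eq_Suc)
    moreover have "2 * s * (t * X) / (s * Y * (s * Y)) * s = 2 * t * (X / (Y * Y))"
      if "s \<noteq> 0" "Y \<noteq> 0" for s t X Y :: complex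
      using that by (simp add: field_simps)
    from this[of "of_nat (Suc m)" "fact m" "of_nat (Suc (2 * m))" "fact (2 * m)"]
    have "2 * of_nat (Suc m) * (of_nat (Suc (2 * m)) * fact (2 * m))
          / (fact (Suc m) * fact (Suc m)) * of_nat (Suc m)
        = 2 * of_nat (Suc (2 * m)) * (fact (2 * m) / (fact m * fact m) :: complex)"
      by (simp only: fact_Suc of_nat_eq_0_iff fact_nonzero nat.distinct not_False_eq_True simp_thms)
    ultimately show ?thesis
      by (simp only: of_nat_mult of_nat_numeral of_nat_Suc) (simp add: add_ac)
  qed
  have "(4 ^ Suc m * ((- 1 / 2 :: complex) gchoose Suc m)) * of_nat (Suc m)
      = 4 * (4 ^ m * ((- 1 / 2) gchoose m)) * (- 1 / 2 - of_nat m)"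
    using gbinomial_Suc_times[of "- 1 / 2 :: complex" m] by (simp only: mult.assoc power_Suc mult.left_commute)
  also have "\<dots> = (- 1) ^ Suc m * (of_nat (2 * Suc m choose Suc m) * of_nat (Suc m))"
    unfolding Suc.IH c by (simp add: algebra_simps)
  finally show ?case
    by (simp only: mult.assoc[symmetric] mult_cancel_right) (simp del: of_nat_Suc)
qed simp

text \<open>Pascal's rule reduces the claim to the exponent \<open>- 1 / 2\<close>, where central binomial coefficients appear.\<close>

lemma half_integer_gbinomial_Ints: "4 ^ m * ((of_nat k + 1 / 2 :: complex) gchoose m) \<in> \<int>"
proof -
  have "4 ^ m * ((of_nat j - 1 / 2 :: complex) gchoose m) \<in> \<int>" for j
  proof (induction j arbitrary: m)
    case 0
    show ?case
      using minus_half_gbinomial[of m] by simp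
  next
    case (Suc j)
    show ?case
    proof (cases m)
      case (Suc m')
      have "(of_nat (Suc j) - 1 / 2 :: complex) gchoose m
          = ((of_nat j - 1 / 2) gchoose m') + ((of_nat j - 1 / 2) gchoose m)"
        using gbinomial_Suc_Suc[of "of_nat j - 1 / 2 :: complex" m'] by (simp add: Suc add_ac algebra_simps)
      then have "4 ^ m * ((of_nat (Suc j) - 1 / 2 :: complex) gchoose m)
          = 4 * (4 ^ m' * ((of_nat j - 1 / 2) gchoose m')) + 4 ^ m * ((of_nat j - 1 / 2) gchoose m)"
        by (simp add: Suc algebra_simps)
      then show ?thesis
        using Suc.IH[of m'] Suc.IH[of m] by (metis Ints_add Ints_mult Ints_numeral)
    qed simp
  qed
  from this[of "Suc k"] show ?thesis
    by (simp add: algebra_simps)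
qed

lemma taylor_coeff_monom: "taylor_coeff (monom 1 m) z h = (if h \<le> m then of_nat (m choose h) * z ^ (m - h) else 0)"
proof -
  have "monom 1 m \<circ>\<^sub>p [:z, 1:] = [:z, 1:] ^ m"
    by (induction m) (simp_all add: monom_Suc pcompose_pCons pcompose_1)
  then show ?thesis
    using coeff_linear_poly_power[of h m z 1]
    by (auto simp: taylor_coeff_def coeff_eq_0 degree_linear_power)
qed

text \<open>The Taylor expansion of \<open>(1 + x v)\<close> to the power \<open>\<alpha>\<close> at \<open>v = z\<close>, rearranged as a limit of Taylor expansions
of polynomials in \<open>v\<close>. It transfers facts on divided differences of polynomials to this power series.\<close>

lemma binomial_series_taylor:
  assumes "cmod (z * x) < 1"
  shows "(\<lambda>m. (\<alpha> gchoose m) * x ^ m * taylor_coeff (monom 1 m) z h)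
    sums ((\<alpha> gchoose h) * x ^ h * (1 + z * x) powr (\<alpha> - of_nat h))"
proof -
  have "(\<lambda>t. (\<alpha> gchoose h) * x ^ h * (((\<alpha> - of_nat h) gchoose t) * (z * x) ^ t))
      sums ((\<alpha> gchoose h) * x ^ h * (1 + z * x) powr (\<alpha> - of_nat h))"
    by (intro sums_mult gen_binomial_complex assms)
  also have "(\<lambda>t. (\<alpha> gchoose h) * x ^ h * (((\<alpha> - of_nat h) gchoose t) * (z * x) ^ t))
      = (\<lambda>t. (\<alpha> gchoose (t + h)) * x ^ (t + h) * taylor_coeff (monom 1 (t + h)) z h)"
  proof
    fix t
    show "(\<alpha> gchoose h) * x ^ h * (((\<alpha> - of_nat h) gchoose t) * (z * x) ^ t)
        = (\<alpha> gchoose (t + h)) * x ^ (t + h) * taylor_coeff (monom 1 (t + h)) z h"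
      using gbinomial_trinomial_revision[of h "t + h" \<alpha>]
      by (simp add: taylor_coeff_monom power_add power_mult_distrib mult_ac binomial_gbinomial)
  qed
  finally show ?thesis
    by (subst (asm) sums_zero_iff_shift) (simp_all add: taylor_coeff_monom)
qed

context three_nodes
begin

text \<open>Divided differences with \<open>n + 1\<close> nodes annihilate polynomials of degree below \<open>n\<close>, so only the part
of order at least \<open>n\<close> of the binomial series in \<open>x\<close> contributes.\<close>

lemma divided_difference_binomial_bound:
  assumes small: "cmod u \<le> 1 / 3" "cmod v \<le> 1 / 3" "cmod w \<le> 1 / 3"
    and x: "cmod x \<le> 1 / 2" and n: "p + q + r = Suc n"
  shows "cmod (divided_difference
      (\<lambda>i h. ((of_nat k + 1 / 2) gchoose h) * x ^ h * (1 + node i * x) powr (of_nat k + 1 / 2 - of_nat h)) p q r)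
    \<le> 2 * 2 ^ k * (3 / 2) ^ n * cmod x ^ n"
proof -
  define \<alpha> :: complex where "\<alpha> = of_nat k + 1 / 2"
  define f where "f i h = (\<alpha> gchoose h) * x ^ h * (1 + node i * x) powr (\<alpha> - of_nat h)" for i h
  define c where "c m = (\<alpha> gchoose m) * x ^ m * top_coeff_mod (node_poly p q r) (monom 1 m)" for m
  have "cmod (node i * x) < 1" for i
  proof -
    have "cmod (node i) \<le> 1 / 3"
      using small by (simp add: node_def)
    then have "cmod (node i) * cmod x \<le> 1 / 3 * (1 / 2)"
      using x by (intro mult_mono) auto
    then show ?thesis
      by (simp add: norm_mult)
  qed
  then have "(\<lambda>m. (\<alpha> gchoose m) * x ^ m * taylor_coeff (monom 1 m) (node i) h) sums f i h" for i h
    unfolding f_def by (rule binomial_series_taylor)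
  then have "(\<lambda>m. divided_difference (\<lambda>i h. (\<alpha> gchoose m) * x ^ m * taylor_coeff (monom 1 m) (node i) h) p q r)
      sums divided_difference f p q r"
    by (rule divided_difference_sums)
  moreover have "divided_difference (\<lambda>i h. (\<alpha> gchoose m) * x ^ m * taylor_coeff (monom 1 m) (node i) h) p q r
      = c m" for m
    unfolding divided_difference_scale c_def by (subst divided_difference_poly) auto
  ultimately have "c sums divided_difference f p q r"
    by simp
  moreover have low: "c m = 0" if "m < n" for m
    using that n by (simp add: c_def top_coeff_mod_low_degree degree_node_poly degree_monom_eq coeff_monom)
  ultimately have "(\<lambda>t. c (t + n)) sums divided_difference f p q r"
    by (subst sums_zero_iff_shift) auto
  moreover have "(\<lambda>t. 2 ^ k * (3 / 2) ^ n * cmod x ^ n * (1 / 2) ^ t)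
      sums (2 ^ k * (3 / 2) ^ n * cmod x ^ n * (1 / (1 - 1 / 2)))"
    by (intro sums_mult geometric_sums) simp
  moreover have "cmod (c (t + n)) \<le> 2 ^ k * (3 / 2) ^ n * cmod x ^ n * (1 / 2) ^ t" for t
  proof -
    have "cmod (c (t + n)) = cmod (\<alpha> gchoose (t + n)) * (cmod x ^ n * cmod x ^ t)
        * cmod (top_coeff_mod (node_poly p q r) (monom 1 (t + n)))"
      by (simp add: c_def norm_mult norm_power power_add mult_ac)
    also have "\<dots> \<le> 2 ^ k * (cmod x ^ n * (1 / 2) ^ t) * (3 / 2) ^ n"
      using half_integer_gbinomial_bound[of k "t + n"] x n
        top_coeff_mod_monom_bound[OF small, of p q r "t + n"]
      by (intro mult_mono power_mono mult_nonneg_nonneg) (auto simp: \<alpha>_def)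
    finally show ?thesis
      by (simp add: mult_ac)
  qed
  ultimately have "cmod (divided_difference f p q r) \<le> 2 ^ k * (3 / 2) ^ n * cmod x ^ n * (1 / (1 - 1 / 2))"
    by (rule norm_sums_le)
  then show ?thesis
    by (simp add: f_def[abs_def] \<alpha>_def mult_ac)
qed

text \<open>The differential equation in the assumption is the one satisfied, at each node, by all multiples of the
power \<open>(1 + x v)\<close> to the \<open>\<alpha>\<close>; the multiples may differ from node to node. Let \<open>H\<close> interpolate the data to
order \<open>k + 1\<close> at each node. When the three divided differences vanish, so do those with more nodes, and \<open>H\<close>
has degree below \<open>3 k\<close> instead of \<open>3 k + 3\<close>. Then \<open>W = (1 + x v) H' - \<alpha> x H\<close> also has degree below \<open>3 k\<close>,
but is divisible by the \<open>k\<close>-th powers of the three linear factors. Hence \<open>W = 0\<close>, and comparing leading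
coefficients, \<open>H = 0\<close>.\<close>

lemma divided_differences_not_all_zero:
  fixes \<alpha> x :: complex
  assumes k: "0 < k" and \<alpha>: "\<alpha> \<notin> \<nat>" and x: "x \<noteq> 0"
    and ode: "\<And>i h. i < 3 \<Longrightarrow> h < k \<Longrightarrow>
      (1 + node i * x) * (of_nat (Suc h) * g i (Suc h)) = (\<alpha> - of_nat h) * x * g i h"
    and zero: "divided_difference g (Suc k) k k = 0" "divided_difference g k (Suc k) k = 0"
      "divided_difference g k k (Suc k) = 0"
  shows "g 0 0 = 0"
proof -
  obtain H where deg0: "degree H < 3 * Suc k"
    and H: "\<And>i h. i < 3 \<Longrightarrow> h < Suc k \<Longrightarrow> taylor_coeff H (node i) h = g i h"
    using hermite_interpolation[of "Suc k" g] by auto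
  have dd: "divided_difference g p q r = top_coeff_mod (node_poly p q r) H"
    if "p \<le> Suc k" "q \<le> Suc k" "r \<le> Suc k" for p q r
    using that H by (intro divided_difference_poly) auto
  have lower: "degree H < n" if "degree H < Suc n" "p + q + r = Suc n"
    "p \<le> Suc k" "q \<le> Suc k" "r \<le> Suc k" "divided_difference g p q r = 0" "0 < n" for n p q r
  proof -
    have "coeff H n = 0"
      using that dd[of p q r] top_coeff_mod_low_degree[of H "node_poly p q r"]
      by (simp add: degree_node_poly)
    then show ?thesis
      using eq_zero_or_degree_less[of H n] that(1,7) by auto
  qed
  have z2: "divided_difference g (Suc k) (Suc k) k = 0" "divided_difference g k (Suc k) (Suc k) = 0"
  proof -
    obtain k' where k': "k = Suc k'"
      using k by (cases k) auto
    show "divided_difference g k (Suc k) (Suc k) = 0"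
      using zero by simp
    have "(u - v) * top_coeff_mod (node_poly (Suc k) (Suc k) k) H
        = top_coeff_mod (node_poly (Suc k) k k) H - top_coeff_mod (node_poly k (Suc k) k) H"
      using top_coeff_mod_two_factors[OF node_poly_nonzero, of u v k k k H]
      by (simp add: node_poly_def mult_ac)
    then show "divided_difference g (Suc k) (Suc k) k = 0"
      using zero dd distinct by simp
  qed
  have z3: "divided_difference g (Suc k) (Suc k) (Suc k) = 0"
  proof -
    have "(u - w) * top_coeff_mod (node_poly (Suc k) (Suc k) (Suc k)) H
        = top_coeff_mod (node_poly (Suc k) (Suc k) k) H - top_coeff_mod (node_poly k (Suc k) (Suc k)) H"
      using top_coeff_mod_two_factors[OF node_poly_nonzero, of u w k "Suc k" k H]
      by (simp add: node_poly_def mult_ac)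
    moreover have "top_coeff_mod (node_poly (Suc k) (Suc k) k) H = 0"
      "top_coeff_mod (node_poly k (Suc k) (Suc k)) H = 0"
      using z2 by (simp_all only: dd order_refl le_Suc_eq simp_thms)
    ultimately have "top_coeff_mod (node_poly (Suc k) (Suc k) (Suc k)) H = 0"
      using distinct by simp
    then show ?thesis
      by (simp only: dd order_refl)
  qed
  have "degree H < Suc (Suc (Suc (3 * k)))"
    using deg0 by simp
  then have "degree H < Suc (Suc (3 * k))"
    by (rule lower[of _ "Suc k" "Suc k" "Suc k"]) (use k z3 in auto)
  then have "degree H < Suc (3 * k)"
    by (rule lower[of _ "Suc k" "Suc k" k]) (use k z2 in auto)
  then have deg: "degree H < 3 * k"
    by (rule lower[of _ "Suc k" k k]) (use k zero in auto)
  define W where "W = [:1, x:] * pderiv H - smult (\<alpha> * x) H"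
  have "lin (node i) ^ k dvd W" if i: "i < 3" for i
    unfolding power_dvd_iff_taylor_coeff
  proof (intro allI impI)
    fix h assume h: "h < k"
    define J where "J = H \<circ>\<^sub>p [:node i, 1:]"
    have J: "coeff J j = g i j" if "j < Suc k" for j
      using H[OF i that] by (simp add: J_def taylor_coeff_def)
    have "W \<circ>\<^sub>p [:node i, 1:] = [:1 + node i * x, x:] * pderiv J - smult (\<alpha> * x) J"
    proof -
      have "pderiv J = pderiv H \<circ>\<^sub>p [:node i, 1:]"
        by (simp add: J_def pderiv_pcompose pderiv_pCons)
      moreover have "[:1, x:] \<circ>\<^sub>p [:node i, 1:] = [:1 + node i * x, x:]"
        by (simp add: pcompose_pCons mult_ac)
      ultimately show ?thesis
        by (simp only: W_def pcompose_diff pcompose_mult pcompose_smult J_def)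
    qed
    also have "\<dots> = smult (1 + node i * x) (pderiv J) + pCons 0 (smult x (pderiv J)) - smult (\<alpha> * x) J"
      by simp
    finally have "taylor_coeff W (node i) h = (1 + node i * x) * (of_nat (Suc h) * g i (Suc h))
        + x * (of_nat h * g i h) - \<alpha> * x * g i h"
      using h J by (cases h) (simp_all add: taylor_coeff_def coeff_pderiv)
    also have "\<dots> = 0"
      unfolding ode[OF i h] by (simp add: algebra_simps)
    finally show "taylor_coeff W (node i) h = 0" .
  qed
  from this[of 0] this[of 1] this[of 2]
  have "lin u ^ k dvd W" "lin v ^ k dvd W" "lin w ^ k dvd W"
    by simp_all
  moreover have "coprime (lin u ^ k) (lin v ^ k)" "coprime (lin u ^ k * lin v ^ k) (lin w ^ k)"
    unfolding coprime_mult_left_iff using distinct coprime_linear_powers by blast+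
  ultimately have dvdW: "node_poly k k k dvd W"
    unfolding node_poly_def by (intro divides_mult)
  have degW: "degree W \<le> degree H"
    unfolding W_def
  proof (rule degree_diff_le)
    show "degree ([:1, x:] * pderiv H) \<le> degree H"
    proof (cases "degree H = 0")
      case True
      then have "pderiv H = 0"
        by (simp add: pderiv_eq_0_iff)
      then show ?thesis by simp
    next
      case False
      have "degree ([:1, x:] * pderiv H) \<le> degree [:1, x:] + degree (pderiv H)"
        by (rule degree_mult_le)
      with False x show ?thesis
        by (simp add: degree_pderiv)
    qed
    show "degree (smult (\<alpha> * x) H) \<le> degree H"
      by (rule degree_smult_le)
  qed
  have "W = 0"
  proof (rule ccontr)
    assume "W \<noteq> 0"
    then have "degree (node_poly k k k) \<le> degree W"
      using dvdW by (rule dvd_imp_degree_le[rotated])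
    then show False
      using degW deg by (simp add: degree_node_poly)
  qed
  have "H = 0"
  proof (rule ccontr)
    assume H0: "H \<noteq> 0"
    define m where "m = degree H"
    have "coeff ([:1, x:] * pderiv H) m = of_nat (Suc m) * coeff H (Suc m) + x * (of_nat m * coeff H m)"
      by (cases m) (simp_all add: coeff_pderiv)
    moreover have "coeff H (Suc m) = 0"
      by (simp add: m_def coeff_eq_0)
    ultimately have "coeff W m = x * (of_nat m - \<alpha>) * coeff H m"
      by (simp add: W_def algebra_simps)
    then have "of_nat m = \<alpha>"
      using \<open>W = 0\<close> x H0 by (simp add: m_def)
    then show False
      using \<alpha> by (metis of_nat_in_Nats)
  qed
  then show ?thesis
    using H[of 0 0] by (simp add: taylor_coeff_def)
qed

end

section \<open>Arithmetic and size of divided differences at reciprocal nodes\<close>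

context quadratic_order
begin

text \<open>Two nodes \<open>0\<close> and \<open>1 / c\<close>: every step of the recursion for divided differences multiplies by \<open>c\<close>. At least
one such step is needed to reach the data at \<open>1 / c\<close> when the node \<open>0\<close> occurs, which saves one factor \<open>c\<close>
of the denominator \<open>c ^ Suc k\<close>.\<close>

lemma integral_recurrence_single:
  fixes E :: "nat \<Rightarrow> nat \<Rightarrow> complex"
  assumes c: "c \<in> R"
    and rec: "\<And>p q. E (Suc p) (Suc q) = c * (E p (Suc q) - E (Suc p) q)"
    and left: "\<And>q. q \<le> n \<Longrightarrow> c ^ Suc k * E 0 q \<in> R"
    and right: "\<And>p. p \<le> n \<Longrightarrow> E p 0 \<in> R"
    and pq: "p \<le> n" "q \<le> n" "0 < p"
  shows "c ^ k * E p q \<in> R"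
proof -
  have step: "c ^ Suc k * E p (Suc q) \<in> R \<Longrightarrow> c ^ Suc k * E (Suc p) q \<in> R \<Longrightarrow> c ^ k * E (Suc p) (Suc q) \<in> R" for p q
  proof -
    assume "c ^ Suc k * E p (Suc q) \<in> R" "c ^ Suc k * E (Suc p) q \<in> R"
    then have "c ^ Suc k * E p (Suc q) - c ^ Suc k * E (Suc p) q \<in> R"
      by (rule diff_mem)
    then show ?thesis
      by (simp add: rec algebra_simps)
  qed
  have all: "c ^ Suc k * E p q \<in> R" if "p \<le> n" "q \<le> n" for p q
    using that
  proof (induction p arbitrary: q)
    case 0
    then show ?case by (intro left)
  next
    case (Suc p)
    from Suc.prems(2) show ?case
    proof (induction q)
      case 0
      then show ?case
        using Suc.prems by (intro mult_mem power_mem c right)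
    next
      case (Suc q)
      have "c ^ k * E (Suc p) (Suc q) \<in> R"
        using Suc Suc.IH \<open>Suc p \<le> n\<close> \<open>\<And>q. p \<le> n \<Longrightarrow> q \<le> n \<Longrightarrow> c ^ Suc k * E p q \<in> R\<close>
        by (intro step) auto
      then have "c * (c ^ k * E (Suc p) (Suc q)) \<in> R"
        by (rule mult_mem[OF c])
      then show ?case
        by (simp add: mult_ac)
    qed
  qed
  obtain p' where p': "p = Suc p'"
    using pq by (cases p) auto
  show "c ^ k * E p q \<in> R"
  proof (cases q)
    case 0
    then show ?thesis
      using pq by (auto intro!: mult_mem power_mem c right)
  next
    case (Suc q')
    show ?thesis
      unfolding p' Suc by (rule step[OF all all]) (use pq p' Suc in auto)
  qed
qed

text \<open>Separating the nodes \<open>1 / a\<close> and \<open>1 / b\<close> costs one factor \<open>d = b - a\<close> in the denominator per step, but each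
step also provides a factor \<open>a b\<close> that cancels denominators of the data. The truncated differences
in the exponents record that the denominators are used up after \<open>k\<close> steps.\<close>

lemma integral_recurrence_double:
  fixes F :: "nat \<Rightarrow> nat \<Rightarrow> complex"
  assumes R: "a \<in> R" "b \<in> R" "d \<in> R"
    and rec: "\<And>q r. d * F (Suc q) (Suc r) = a * b * (F (Suc q) r - F q (Suc r))"
    and left: "\<And>q. q \<le> n \<Longrightarrow> a ^ k * F q 0 \<in> R"
    and right: "\<And>r. r \<le> n \<Longrightarrow> b ^ k * F 0 r \<in> R"
  shows "q \<le> n \<Longrightarrow> r \<le> n \<Longrightarrow> a ^ (k - r) * b ^ (k - q) * d ^ (q + r - 1) * F q r \<in> R"
proof (induction q arbitrary: r)
  case 0
  have "a ^ (k - r) * d ^ (r - 1) * (b ^ k * F 0 r) \<in> R"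
    using 0 R by (intro mult_mem power_mem right)
  then show ?case
    by (simp add: mult_ac)
next
  case (Suc q)
  from Suc.prems(2) show ?case
  proof (induction r)
    case 0
    have "b ^ (k - Suc q) * d ^ q * (a ^ k * F (Suc q) 0) \<in> R"
      using Suc.prems R by (intro mult_mem power_mem left)
    then show ?case
      by (simp add: mult_ac)
  next
    case (Suc r)
    have shift: "\<exists>e\<in>R. z * z ^ (k - Suc m) = z ^ (k - m) * e" if "z \<in> R" for z m
    proof (cases "m < k")
      case True
      then have "z * z ^ (k - Suc m) = z ^ (k - m) * 1"
        by (simp flip: power_Suc add: Suc_diff_Suc)
      then show ?thesis
        using one_mem by blast
    next
      case False
      with that show ?thesis by auto
    qed
    obtain ea where ea: "ea \<in> R" "a * a ^ (k - Suc r) = a ^ (k - r) * ea"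
      using shift[OF R(1)] by blast
    obtain eb where eb: "eb \<in> R" "b * b ^ (k - Suc q) = b ^ (k - q) * eb"
      using shift[OF R(2)] by blast
    have X: "a ^ (k - r) * b ^ (k - Suc q) * d ^ (q + r) * F (Suc q) r \<in> R"
      using Suc by simp
    have Y: "a ^ (k - Suc r) * b ^ (k - q) * d ^ (q + r) * F q (Suc r) \<in> R"
      using \<open>\<And>r. q \<le> n \<Longrightarrow> r \<le> n \<Longrightarrow> a ^ (k - r) * b ^ (k - q) * d ^ (q + r - 1) * F q r \<in> R\<close>[of "Suc r"]
        Suc.prems \<open>Suc q \<le> n\<close> by simp
    have "a ^ (k - Suc r) * b ^ (k - Suc q) * d ^ (Suc q + Suc r - 1) * F (Suc q) (Suc r)
        = a ^ (k - Suc r) * b ^ (k - Suc q) * d ^ (q + r) * (d * F (Suc q) (Suc r))"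
      by (simp add: mult_ac)
    also have "\<dots> = b * (a * a ^ (k - Suc r)) * b ^ (k - Suc q) * d ^ (q + r) * F (Suc q) r
        - a * (b * b ^ (k - Suc q)) * a ^ (k - Suc r) * d ^ (q + r) * F q (Suc r)"
      unfolding rec by (simp add: algebra_simps)
    also have "\<dots> = b * ea * (a ^ (k - r) * b ^ (k - Suc q) * d ^ (q + r) * F (Suc q) r)
        - a * eb * (a ^ (k - Suc r) * b ^ (k - q) * d ^ (q + r) * F q (Suc r))"
      unfolding ea eb by (simp add: mult_ac)
    also have "\<dots> \<in> R"
      using diff_mem[OF mult_mem[OF mult_mem[OF R(2) ea(1)] X] mult_mem[OF mult_mem[OF R(1) eb(1)] Y]] .
    finally show ?case .
  qed
qed

end

text \<open>The same two recursions for absolute values. Each step doubles the number of terms and multiplies by at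
most \<open>B\<close> here, and by at most \<open>B\<^sup>2 / d\<close> in the next lemma. The factor \<open>2 B\<close> on the left avoids exponents that are negative in degenerate cases.\<close>

lemma bounded_recurrence_single:
  fixes E :: "nat \<Rightarrow> nat \<Rightarrow> complex"
  assumes B: "1 \<le> 2 * B" and G: "0 \<le> G"
    and rec: "\<And>p q. cmod (E (Suc p) (Suc q)) \<le> B * (cmod (E p (Suc q)) + cmod (E (Suc p) q))"
    and left: "\<And>q. q \<le> n \<Longrightarrow> cmod (E 0 q) \<le> G"
    and right: "\<And>p. E p 0 = 0"
  shows "q \<le> n \<Longrightarrow> 2 * B * cmod (E p q) \<le> (2 * B) ^ (p + q) * G"
proof (induction p arbitrary: q)
  case 0
  show ?case
  proof (cases q)
    case (Suc q')
    have "1 * (2 * B * cmod (E 0 q)) \<le> (2 * B) ^ q' * (2 * B * G)"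
      using B G left[OF 0] by (intro mult_mono one_le_power) auto
    then show ?thesis
      by (simp add: Suc mult_ac)
  qed (use G right in simp)
next
  case (Suc p)
  from Suc.prems show ?case
  proof (induction q)
    case 0
    then show ?case
      using right B G by simp
  next
    case (Suc q)
    have "2 * B * cmod (E (Suc p) (Suc q)) \<le> 2 * B * (B * (cmod (E p (Suc q)) + cmod (E (Suc p) q)))"
      using B by (intro mult_left_mono rec) auto
    also have "\<dots> = B * (2 * B * cmod (E p (Suc q)) + 2 * B * cmod (E (Suc p) q))"
      by (simp add: algebra_simps)
    also have "\<dots> \<le> B * ((2 * B) ^ (p + Suc q) * G + (2 * B) ^ (Suc p + q) * G)"
    proof (rule mult_left_mono[OF add_mono])
      show "2 * B * cmod (E p (Suc q)) \<le> (2 * B) ^ (p + Suc q) * G"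
        by (rule \<open>\<And>q. q \<le> n \<Longrightarrow> 2 * B * cmod (E p q) \<le> (2 * B) ^ (p + q) * G\<close>) fact
      show "2 * B * cmod (E (Suc p) q) \<le> (2 * B) ^ (Suc p + q) * G"
        by (rule Suc.IH) (use Suc.prems in simp)
    qed (use B in simp)
    also have "\<dots> = (2 * B) ^ (Suc p + Suc q) * G"
      by (simp add: algebra_simps)
    finally show ?case .
  qed
qed

lemma bounded_recurrence_double:
  fixes F :: "nat \<Rightarrow> nat \<Rightarrow> complex"
  assumes B: "1 \<le> 2 * B" and G: "0 \<le> G" and d: "0 \<le> d" "d \<le> 2 * B"
    and rec: "\<And>q r. d * cmod (F (Suc q) (Suc r)) \<le> B\<^sup>2 * (cmod (F (Suc q) r) + cmod (F q (Suc r)))"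
    and left: "\<And>q. q \<le> n \<Longrightarrow> 2 * B * cmod (F q 0) \<le> (2 * B) ^ (p + q) * G"
    and right: "\<And>r. r \<le> n \<Longrightarrow> 2 * B * cmod (F 0 r) \<le> (2 * B) ^ (p + r) * G"
    and corner: "F 0 0 = 0"
  shows "q \<le> n \<Longrightarrow> r \<le> n \<Longrightarrow>
    (2 * B)\<^sup>2 * (d ^ (q + r - 1) * cmod (F q r)) \<le> (2 * B) ^ (2 * (q + r) + p) * G"
proof -
  have side: "(2 * B)\<^sup>2 * (d ^ (m - 1) * cmod z) \<le> (2 * B) ^ (2 * m + p) * G"
    if z: "2 * B * cmod z \<le> (2 * B) ^ (p + m) * G" and m: "0 < m" for m z
  proof -
    have "(2 * B)\<^sup>2 * (d ^ (m - 1) * cmod z) = (2 * B) * d ^ (m - 1) * (2 * B * cmod z)"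
      by (simp add: power2_eq_square)
    also have "\<dots> \<le> (2 * B) * (2 * B) ^ (m - 1) * ((2 * B) ^ (p + m) * G)"
    proof (rule mult_mono[OF _ z])
      show "2 * B * d ^ (m - 1) \<le> 2 * B * (2 * B) ^ (m - 1)"
        using d B by (intro mult_left_mono power_mono) auto
    qed (use B in auto)
    also have "(2 * B) * (2 * B) ^ (m - 1) = (2 * B) ^ m"
      using m by (cases m) simp_all
    also have "(2 * B) ^ m * ((2 * B) ^ (p + m) * G) = (2 * B) ^ (2 * m + p) * G"
      by (simp only: mult.assoc[symmetric] power_add[symmetric] mult_2 add_ac)
    finally show ?thesis .
  qed
  show "q \<le> n \<Longrightarrow> r \<le> n \<Longrightarrow>
    (2 * B)\<^sup>2 * (d ^ (q + r - 1) * cmod (F q r)) \<le> (2 * B) ^ (2 * (q + r) + p) * G"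
  proof (induction q arbitrary: r)
    case zero: 0
    show ?case
    proof (cases r)
      case 0
      then show ?thesis
        using corner B G by simp
    next
      case (Suc r')
      then show ?thesis
        using side[OF right[OF zero(2)]] by (simp only: add_0 zero_less_Suc)
    qed
  next
    case (Suc q)
    from Suc.prems(2) show ?case
    proof (induction r)
      case 0
      then show ?case
        using side[OF left[OF \<open>Suc q \<le> n\<close>]] by (simp only: add_0_right zero_less_Suc)
    next
      case (Suc r)
      have "(2 * B)\<^sup>2 * (d ^ (Suc q + Suc r - 1) * cmod (F (Suc q) (Suc r)))
          = (2 * B)\<^sup>2 * d ^ (q + r) * (d * cmod (F (Suc q) (Suc r)))"
        by (simp add: mult_ac)
      also have "\<dots> \<le> (2 * B)\<^sup>2 * d ^ (q + r) * (B\<^sup>2 * (cmod (F (Suc q) r) + cmod (F q (Suc r))))"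
        using d by (intro mult_left_mono rec) auto
      also have "\<dots> = B\<^sup>2 * ((2 * B)\<^sup>2 * (d ^ (q + r) * cmod (F (Suc q) r)) + (2 * B)\<^sup>2 * (d ^ (q + r) * cmod (F q (Suc r))))"
        by (simp add: algebra_simps)
      also have "\<dots> \<le> B\<^sup>2 * ((2 * B) ^ (2 * (Suc q + r) + p) * G + (2 * B) ^ (2 * (q + Suc r) + p) * G)"
      proof (rule mult_left_mono[OF add_mono])
        show "(2 * B)\<^sup>2 * (d ^ (q + r) * cmod (F (Suc q) r)) \<le> (2 * B) ^ (2 * (Suc q + r) + p) * G"
          using Suc by simp
        show "(2 * B)\<^sup>2 * (d ^ (q + r) * cmod (F q (Suc r))) \<le> (2 * B) ^ (2 * (q + Suc r) + p) * G"
          using \<open>\<And>r. q \<le> n \<Longrightarrow> r \<le> n \<Longrightarrow> (2 * B)\<^sup>2 * (d ^ (q + r - 1) * cmod (F q r)) \<le> (2 * B) ^ (2 * (q + r) + p) * G\<close>[of "Suc r"]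
            Suc.prems \<open>Suc q \<le> n\<close> by simp
      qed simp
      also have "\<dots> = 2 * B\<^sup>2 * ((2 * B) ^ (2 * (Suc q + r) + p) * G)"
        by simp
      also have "\<dots> \<le> (2 * B)\<^sup>2 * ((2 * B) ^ (2 * (Suc q + r) + p) * G)"
        using B G by (intro mult_right_mono) (simp_all add: power_mult_distrib)
      also have "\<dots> = (2 * B) ^ (2 * (Suc q + Suc r) + p) * G"
        by (simp add: power2_eq_square power_add mult_ac)
      finally show ?case .
    qed
  qed
qed

text \<open>The values of \<open>1 - v / c\<close> at the nodes \<open>1 / a\<close> and \<open>1 / b\<close> are squares up to factors \<open>a c\<close> and \<open>b c\<close>, since
\<open>1 - 1 / (a c) = (a c - 1) / (a c)\<close>.\<close>

locale reciprocal_nodes =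
  fixes a b :: complex
  assumes ab_nonzero: "a \<noteq> 0" "b \<noteq> 0" and ab_distinct: "a \<noteq> b"

sublocale reciprocal_nodes \<subseteq> three_nodes 0 "1 / a" "1 / b"
  by standard (use ab_nonzero ab_distinct in auto)

context reciprocal_nodes
begin

lemma recurrence_0_a:
  "divided_difference g (Suc p) (Suc q) 0
    = a * (divided_difference g p (Suc q) 0 - divided_difference g (Suc p) q 0)"
proof -
  have "(x - y) / (0 - 1 / a) = a * (y - x)" for x y
    using ab_nonzero by (simp add: field_simps)
  then show ?thesis
    by (simp only: divided_difference.simps)
qed

lemma recurrence_0_b:
  "divided_difference g (Suc p) 0 (Suc r)
    = b * (divided_difference g p 0 (Suc r) - divided_difference g (Suc p) 0 r)"
proof -
  have "(x - y) / (0 - 1 / b) = b * (y - x)" for x y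
    using ab_nonzero by (simp add: field_simps)
  then show ?thesis
    by (simp only: divided_difference.simps)
qed

lemma recurrence_a_b:
  "(b - a) * divided_difference g p (Suc q) (Suc r)
    = a * b * (divided_difference g p (Suc q) r - divided_difference g p q (Suc r))"
proof -
  have "(b - a) * ((x - y) / (1 / a - 1 / b)) = a * b * (x - y)" for x y
    using ab_nonzero ab_distinct by (simp add: field_simps)
  then show ?thesis
    by (simp only: divided_difference.simps)
qed

lemma single_node:
  "divided_difference g 0 q 0 = (if q = 0 then 0 else g 1 (q - 1))"
  "divided_difference g 0 0 q = (if q = 0 then 0 else g 2 (q - 1))"
  "divided_difference g q 0 0 = (if q = 0 then 0 else g 0 (q - 1))"
  by (cases q; simp)+

lemma divided_difference_integral:
  assumes "quadratic_order R" and R: "a \<in> R" "b \<in> R"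
    and g: "\<And>h. h \<le> k \<Longrightarrow> g 0 h \<in> R" "\<And>h. h \<le> k \<Longrightarrow> a ^ Suc k * g 1 h \<in> R"
      "\<And>h. h \<le> k \<Longrightarrow> b ^ Suc k * g 2 h \<in> R"
    and pqr: "0 < k" "k \<le> p" "k \<le> q" "k \<le> r" "p + q + r = 3 * k + 1"
  shows "(b - a) ^ (2 * k) * divided_difference g p q r \<in> R"
proof -
  interpret quadratic_order R by fact
  have le: "p \<le> Suc k" "q \<le> Suc k" "r \<le> Suc k" "0 < p" and d: "b - a \<in> R"
    using pqr R diff_mem by auto
  have A: "a ^ k * divided_difference g p q 0 \<in> R" if "q \<le> Suc k" for q
  proof (rule integral_recurrence_single[where n = "Suc k" and E = "\<lambda>p q. divided_difference g p q 0"])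
    show "a ^ Suc k * divided_difference g 0 q 0 \<in> R" if "q \<le> Suc k" for q
      using g(2)[of "q - 1"] that by (cases "q = 0") (simp_all only: single_node, simp_all add: zero_mem)
    show "divided_difference g p 0 0 \<in> R" if "p \<le> Suc k" for p
      using g(1)[of "p - 1"] that by (simp add: single_node zero_mem)
  qed (use R le that recurrence_0_a in auto)
  have B: "b ^ k * divided_difference g p 0 r \<in> R" if "r \<le> Suc k" for r
  proof (rule integral_recurrence_single[where n = "Suc k" and E = "\<lambda>p q. divided_difference g p 0 q"])
    show "b ^ Suc k * divided_difference g 0 0 q \<in> R" if "q \<le> Suc k" for q
      using g(3)[of "q - 1"] that by (cases "q = 0") (simp_all only: single_node, simp_all add: zero_mem)
    show "divided_difference g p 0 0 \<in> R" if "p \<le> Suc k" for p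
      using g(1)[of "p - 1"] that by (simp add: single_node zero_mem)
  qed (use R le that recurrence_0_b in auto)
  have "a ^ (k - r) * b ^ (k - q) * (b - a) ^ (q + r - 1) * divided_difference g p q r \<in> R"
    using le by (intro integral_recurrence_double[where n = "Suc k"] R d recurrence_a_b A B)
  then have "(b - a) ^ (q + r - 1) * divided_difference g p q r \<in> R"
    using pqr by simp
  then have "(b - a) ^ (2 * k - (q + r - 1)) * ((b - a) ^ (q + r - 1) * divided_difference g p q r) \<in> R"
    by (rule mult_mem[OF power_mem[OF d]])
  moreover have "2 * k = (2 * k - (q + r - 1)) + (q + r - 1)"
    using pqr by simp
  ultimately show ?thesis
    by (metis mult.assoc power_add)
qed

lemma divided_difference_bound:
  assumes B: "1 \<le> 2 * B" "cmod a \<le> B" "cmod b \<le> B" and G: "0 \<le> G"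
    and g: "\<And>h. g 0 h = 0" "\<And>h. h \<le> k \<Longrightarrow> cmod (g 1 h) \<le> G" "\<And>h. h \<le> k \<Longrightarrow> cmod (g 2 h) \<le> G"
    and pqr: "0 < k" "k \<le> p" "k \<le> q" "k \<le> r" "p + q + r = 3 * k + 1"
  shows "cmod ((b - a) ^ (2 * k) * divided_difference g p q r) \<le> (2 * B) ^ (5 * k) * G"
proof -
  have le: "p \<le> Suc k" "q \<le> Suc k" "r \<le> Suc k"
    using pqr by auto
  have d: "cmod (b - a) \<le> 2 * B"
    using norm_triangle_ineq4[of b a] B by simp
  have rec: "cmod (z * (x - y)) \<le> B * (cmod x + cmod y)" if "cmod z \<le> B" for x y z
    unfolding norm_mult using that B norm_triangle_ineq4[of x y] by (intro mult_mono) auto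
  have A: "2 * B * cmod (divided_difference g p q 0) \<le> (2 * B) ^ (p + q) * G" if "q \<le> Suc k" for q
    using that g G
    by (intro bounded_recurrence_single[where n = "Suc k" and E = "\<lambda>p q. divided_difference g p q 0"] B G)
       (auto simp: single_node recurrence_0_a rec[OF B(2)] simp del: divided_difference.simps)
  have A': "2 * B * cmod (divided_difference g p 0 r) \<le> (2 * B) ^ (p + r) * G" if "r \<le> Suc k" for r
    using that g G
    by (intro bounded_recurrence_single[where n = "Suc k" and E = "\<lambda>p q. divided_difference g p 0 q"] B G)
       (auto simp: single_node recurrence_0_b rec[OF B(3)] simp del: divided_difference.simps)
  have recd: "cmod (b - a) * cmod (divided_difference g p (Suc q) (Suc r))
      \<le> B\<^sup>2 * (cmod (divided_difference g p (Suc q) r) + cmod (divided_difference g p q (Suc r)))" for q r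
  proof -
    have "cmod (b - a) * cmod (divided_difference g p (Suc q) (Suc r))
        = cmod a * cmod b * cmod (divided_difference g p (Suc q) r - divided_difference g p q (Suc r))"
      using arg_cong[OF recurrence_a_b[of g p q r], of cmod] by (simp only: norm_mult)
    also have "\<dots> \<le> B * B * (cmod (divided_difference g p (Suc q) r) + cmod (divided_difference g p q (Suc r)))"
      using B norm_triangle_ineq4 by (intro mult_mono mult_nonneg_nonneg) auto
    finally show ?thesis
      by (simp only: power2_eq_square)
  qed
  have main: "(2 * B)\<^sup>2 * (cmod (b - a) ^ (q + r - 1) * cmod (divided_difference g p q r))
      \<le> (2 * B) ^ (2 * (q + r) + p) * G"
    using le by (intro bounded_recurrence_double[where n = "Suc k"] B G d recd A A')
      (simp_all add: single_node g del: divided_difference.simps)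
  have "(2 * B)\<^sup>2 * cmod ((b - a) ^ (2 * k) * divided_difference g p q r)
      = cmod (b - a) ^ (2 * k - (q + r - 1)) * ((2 * B)\<^sup>2 * (cmod (b - a) ^ (q + r - 1) * cmod (divided_difference g p q r)))"
  proof -
    have "2 * k = (2 * k - (q + r - 1)) + (q + r - 1)"
      using pqr by simp
    then have "cmod (b - a) ^ (2 * k) = cmod (b - a) ^ (2 * k - (q + r - 1)) * cmod (b - a) ^ (q + r - 1)"
      by (metis power_add)
    then show ?thesis
      by (simp add: norm_mult norm_power)
  qed
  also have "\<dots> \<le> (2 * B) ^ (2 * k - (q + r - 1)) * ((2 * B) ^ (2 * (q + r) + p) * G)"
    using d B by (intro mult_mono power_mono main) auto
  also have "\<dots> = (2 * B)\<^sup>2 * ((2 * B) ^ (5 * k) * G)"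
  proof -
    have "(2 * k - (q + r - 1)) + (2 * (q + r) + p) = 2 + 5 * k"
      using pqr by simp
    then have "(2 * B) ^ (2 * k - (q + r - 1)) * (2 * B) ^ (2 * (q + r) + p) = (2 * B)\<^sup>2 * (2 * B) ^ (5 * k)"
      by (metis power_add)
    then show ?thesis
      by (simp only: mult.assoc[symmetric])
  qed
  finally show ?thesis
    using B by (subst (asm) mult_le_cancel_left_pos) auto
qed

end

section \<open>Simultaneous approximation of two square roots\<close>

lemma close_square_root:
  fixes p z :: complex
  obtains \<sigma> :: complex where "\<sigma> = 1 \<or> \<sigma> = -1" "cmod (\<sigma> * p - z) * cmod z \<le> cmod (p\<^sup>2 - z\<^sup>2)"
proof -
  define \<sigma> :: complex where "\<sigma> = (if 0 \<le> Re (p * cnj z) then 1 else -1)"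
  have s: "\<sigma> = 1 \<or> \<sigma> = -1" "0 \<le> Re (\<sigma> * p * cnj z)"
    by (auto simp: \<sigma>_def)
  have "(cmod z)\<^sup>2 \<le> (cmod (\<sigma> * p + z))\<^sup>2"
  proof -
    have "(cmod (\<sigma> * p + z))\<^sup>2 = (cmod (\<sigma> * p))\<^sup>2 + (cmod z)\<^sup>2 + 2 * Re (\<sigma> * p * cnj z)"
      unfolding cmod_power2 by (simp add: power2_eq_square algebra_simps)
    then show ?thesis
      using s(2) by simp
  qed
  then have le: "cmod z \<le> cmod (\<sigma> * p + z)"
    by (rule power2_le_imp_le) simp
  have "p\<^sup>2 - z\<^sup>2 = (\<sigma> * p - z) * (\<sigma> * p + z)"
    using s(1) by (auto simp: power2_eq_square algebra_simps)
  then have "cmod (p\<^sup>2 - z\<^sup>2) = cmod (\<sigma> * p - z) * cmod (\<sigma> * p + z)"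
    by (simp only: norm_mult)
  also have "cmod (\<sigma> * p - z) * cmod z \<le> \<dots>"
    using le by (intro mult_left_mono) auto
  finally show ?thesis
    using that s(1) by blast
qed

text \<open>The intervals \<open>\<gamma> ^ (6 k - 3) \<le> D\<^sup>2 < \<gamma> ^ (6 k + 3)\<close> cover a half line, and \<open>k\<close> is determined by the one that
contains \<open>D\<close>. The two inequalities hold roughly for \<open>D\<close> between the powers of \<open>\<gamma>\<close> with exponents
\<open>2 k + 1\<close> and \<open>4 k - 1\<close>; the losses from \<open>P\<close> and \<open>Q\<close> are \<open>k / 3\<close> and \<open>k / 6\<close> in the exponent. The case
\<open>k = 3\<close> is tight and needs the full strength of \<open>\<gamma> ^ 8 \<le> D\<close>.\<close>

lemma approximation_order:
  fixes \<gamma> D P Q :: real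
  assumes \<gamma>: "2 \<le> \<gamma>" "\<gamma> ^ 8 \<le> D" and P: "0 \<le> P" "P ^ 6 \<le> \<gamma>" and Q: "0 \<le> Q" "Q ^ 12 \<le> \<gamma>"
  obtains k where "3 \<le> k" "P ^ (2 * k) * \<gamma> ^ (2 * k + 1) \<le> D" "\<gamma> * D * Q ^ (2 * k) \<le> \<gamma> ^ (4 * k)"
proof -
  have D0: "0 \<le> D"
    using \<gamma> by (meson order_trans zero_le_power zero_le_numeral)
  have mono: "\<gamma> ^ i \<le> \<gamma> ^ j" if "i \<le> j" for i j
    using that \<gamma> by (intro power_increasing) auto
  obtain N where N: "D\<^sup>2 < \<gamma> ^ N"
    using real_arch_pow[of \<gamma> "D\<^sup>2"] \<gamma> by auto
  have ex: "\<exists>n. D\<^sup>2 < \<gamma> ^ (6 * n + 3)"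
    using N mono[of N "6 * N + 3"] by (intro exI[of _ N]) auto
  define k where "k = (LEAST n. D\<^sup>2 < \<gamma> ^ (6 * n + 3))"
  have up: "D\<^sup>2 < \<gamma> ^ (6 * k + 3)"
    unfolding k_def by (rule LeastI_ex[OF ex])
  have D2: "\<gamma> ^ 16 \<le> D\<^sup>2"
  proof -
    have "(\<gamma> ^ 8)\<^sup>2 \<le> D\<^sup>2"
      using \<gamma> by (intro power_mono) auto
    then show ?thesis
      by (simp flip: power_mult)
  qed
  have k3: "3 \<le> k"
  proof (rule ccontr)
    assume "\<not> 3 \<le> k"
    then have "\<gamma> ^ (6 * k + 3) \<le> \<gamma> ^ 16"
      by (intro mono) simp
    with up D2 show False by simp
  qed
  have low: "\<gamma> ^ (6 * k - 3) \<le> D\<^sup>2"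
  proof -
    have "\<not> D\<^sup>2 < \<gamma> ^ (6 * (k - 1) + 3)"
      unfolding k_def by (rule not_less_Least) (use k3 k_def in simp)
    moreover have "6 * (k - 1) + 3 = 6 * k - 3"
      using k3 by simp
    ultimately show ?thesis by simp
  qed
  show ?thesis
  proof (rule that[OF k3])
    show "P ^ (2 * k) * \<gamma> ^ (2 * k + 1) \<le> D"
    proof (rule power_le_imp_le_base)
      have "(P ^ (2 * k) * \<gamma> ^ (2 * k + 1)) ^ Suc 5 = (P ^ 6) ^ (2 * k) * \<gamma> ^ (12 * k + 6)"
        by (simp only: power_mult_distrib power_mult[symmetric]) (simp add: algebra_simps)
      also have "\<dots> \<le> \<gamma> ^ (2 * k) * \<gamma> ^ (12 * k + 6)"
        using P \<gamma> by (intro mult_right_mono power_mono) auto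
      also have "\<dots> = \<gamma> ^ (14 * k + 6)"
        by (simp flip: power_add)
      also have "\<dots> \<le> (D\<^sup>2) ^ 3"
      proof (cases "k = 3")
        case True
        have "\<gamma> ^ (14 * k + 6) = (\<gamma> ^ 16) ^ 3"
          by (simp add: True flip: power_mult)
        also have "\<dots> \<le> (D\<^sup>2) ^ 3"
          using D2 \<gamma> by (intro power_mono) auto
        finally show ?thesis .
      next
        case False
        then have "\<gamma> ^ (14 * k + 6) \<le> \<gamma> ^ ((6 * k - 3) * 3)"
          using k3 by (intro mono) simp
        also have "\<dots> = (\<gamma> ^ (6 * k - 3)) ^ 3"
          by (rule power_mult)
        also have "\<dots> \<le> (D\<^sup>2) ^ 3"
          using low \<gamma> by (intro power_mono) auto
        finally show ?thesis .
      qed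
      also have "\<dots> = D ^ Suc 5"
        by (simp flip: power_mult)
      finally show "(P ^ (2 * k) * \<gamma> ^ (2 * k + 1)) ^ Suc 5 \<le> D ^ Suc 5" .
    qed (rule D0)
    show "\<gamma> * D * Q ^ (2 * k) \<le> \<gamma> ^ (4 * k)"
    proof (rule power_le_imp_le_base)
      have "(\<gamma> * D * Q ^ (2 * k)) ^ Suc 5 = \<gamma> ^ 6 * (D\<^sup>2) ^ 3 * (Q ^ 12) ^ k"
        by (simp only: power_mult_distrib power_mult[symmetric]) (simp add: algebra_simps)
      also have "\<dots> \<le> \<gamma> ^ 6 * (\<gamma> ^ (6 * k + 3)) ^ 3 * \<gamma> ^ k"
        using up Q \<gamma> by (intro mult_mono power_mono mult_nonneg_nonneg) auto
      also have "\<dots> = \<gamma> ^ (6 + (6 * k + 3) * 3 + k)"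
        by (simp only: power_add power_mult)
      also have "\<dots> \<le> \<gamma> ^ (4 * k * Suc 5)"
        using k3 by (intro mono) simp
      also have "\<dots> = (\<gamma> ^ (4 * k)) ^ Suc 5"
        by (rule power_mult)
      finally show "(\<gamma> * D * Q ^ (2 * k)) ^ Suc 5 \<le> (\<gamma> ^ (4 * k)) ^ Suc 5" .
    qed (use \<gamma> in simp)
  qed
qed

context quadratic_order
begin

text \<open>As \<open>1 - 1 / (a c) = s\<^sup>2 / (a c)\<close>, the Taylor coefficients of the power series at \<open>1 / a\<close>, taken with the
factor that replaces its square root by \<open>s y / a\<close>, have denominators dividing a power of \<open>4\<close> times
\<open>c ^ k a ^ Suc k\<close>.\<close>

lemma scaled_taylor_coeff_integral:
  assumes R: "a \<in> R" "c \<in> R" "s \<in> R" "y \<in> R" and a0: "a \<noteq> 0" "c \<noteq> 0"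
    and sq: "a * c - 1 = s\<^sup>2" and hk: "h \<le> k"
  shows "a ^ Suc k * (4 ^ k * c ^ k *
      (((of_nat k + 1 / 2) gchoose h) * (- 1 / c) ^ h * (1 + 1 / a * (- 1 / c)) ^ (k - h) * (s * y / a))) \<in> R"
proof -
  have e: "k = (k - h) + h"
    using hk by simp
  have "1 + 1 / a * (- 1 / c) = s\<^sup>2 / (a * c)"
    using a0 by (simp add: sq[symmetric] field_simps)
  moreover have "a ^ Suc k * (4 ^ k * c ^ k * (G * (- 1 / c) ^ h * (s\<^sup>2 / (a * c)) ^ (k - h) * (s * y / a)))
      = 4 ^ (k - h) * (4 ^ h * G) * (- 1) ^ h * a ^ h * (s\<^sup>2) ^ (k - h) * s * y" for G
  proof -
    have "(a ^ k = a ^ (k - h) * a ^ h)" "(4 ^ k = 4 ^ (k - h) * (4 ^ h :: complex))" "c ^ k = c ^ (k - h) * c ^ h"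
      using e by (metis power_add)+
    moreover have "(- (1 / c)) ^ h = (- 1) ^ h / c ^ h"
      by (metis power_divide minus_divide_left)
    ultimately show ?thesis
      using a0 by (simp add: power_divide power_mult_distrib)
  qed
  moreover have "4 ^ (k - h) * (4 ^ h * ((of_nat k + 1 / 2) gchoose h)) * (- 1) ^ h * a ^ h * (s\<^sup>2) ^ (k - h) * s * y \<in> R"
  proof -
    have "4 ^ (k - h) * J * (- 1) ^ h * a ^ h * (s\<^sup>2) ^ (k - h) * s * y \<in> R" if "J \<in> R" for J
      using that R by (intro mult_mem power_mem numeral_mem uminus_mem one_mem)
    from this[OF int_mem[OF half_integer_gbinomial_Ints]] show ?thesis .
  qed
  ultimately show ?thesis
    by metis
qed

text \<open>The hypergeometric method. Let \<open>f(v) = (1 - v / c) ^ (k + 1/2)\<close>. The numbers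
\<open>z\<^sup>2 = c d - 1\<close>, \<open>(s x / a)\<^sup>2 / (1 - 1 / (a c)) = c d - c / a\<close> and
\<open>(t y / b)\<^sup>2 / (1 - 1 / (b c)) = c d - c / b\<close> differ by much less than their size, and so do suitable square
roots \<open>\<kappa> 0, \<kappa> 1, \<kappa> 2\<close>. Take the divided difference at the nodes \<open>0, 1 / a, 1 / b\<close> of the data given by
\<open>\<kappa> i\<close> times \<open>f\<close> at the \<open>i\<close>-th node. On the one hand these data differ little from \<open>z f\<close>, whose divided
difference is of the order of \<open>z c ^ (- 3 k)\<close>. On the other hand the factors \<open>\<kappa> i\<close> turn the square root of
\<open>1 - v / c\<close> into \<open>z\<close>, \<open>s x / a\<close> and \<open>t y / b\<close>, so the divided difference lies in \<open>R\<close> after multiplication by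
\<open>4 ^ k c ^ k (b - a) ^ (2 k)\<close>. For the right \<open>k\<close> it has to vanish, whichever node has the multiplicity
\<open>k + 1\<close>, which contradicts the nonvanishing lemma.\<close>

lemma no_far_extension:
  assumes R: "a \<in> R" "b \<in> R" "c \<in> R" "d \<in> R"
    and sq: "s \<in> R" "a * c - 1 = s\<^sup>2" "t \<in> R" "b * c - 1 = t\<^sup>2" "x \<in> R" "a * d - 1 = x\<^sup>2"
      "y \<in> R" "b * d - 1 = y\<^sup>2" "z \<in> R" "c * d - 1 = z\<^sup>2"
    and ab: "a \<noteq> b" "3 \<le> cmod a" "cmod a \<le> B" "3 \<le> cmod b" "cmod b \<le> B"
    and c: "(1024 * B ^ 5) ^ 6 \<le> cmod c" "(256 * B\<^sup>2) ^ 12 \<le> cmod c"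
    and d: "cmod c ^ 8 \<le> cmod d"
  shows False
proof -
  define \<gamma> D where "\<gamma> = cmod c" and "D = cmod d"
  have B: "3 \<le> B"
    using ab by simp
  have \<gamma>6: "6 \<le> \<gamma>"
  proof -
    have "1 \<le> B ^ 5"
      using B by (intro one_le_power) simp
    then have "1024 ^ 6 \<le> (1024 * B ^ 5) ^ 6"
      by (intro power_mono) auto
    then show ?thesis
      using c(1) by (simp add: \<gamma>_def)
  qed
  have D1: "1 \<le> D"
  proof -
    have "1 \<le> \<gamma> ^ 8"
      using \<gamma>6 by (intro one_le_power) simp
    then show ?thesis
      using d by (simp add: \<gamma>_def D_def)
  qed
  have \<gamma>D: "6 \<le> \<gamma> * D"
    using mult_mono[OF \<gamma>6 D1] \<gamma>6 by simp
  obtain k where k: "3 \<le> k" "(1024 * B ^ 5) ^ (2 * k) * \<gamma> ^ (2 * k + 1) \<le> D"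
      "\<gamma> * D * (256 * B\<^sup>2) ^ (2 * k) \<le> \<gamma> ^ (4 * k)"
    using approximation_order[of \<gamma> D "1024 * B ^ 5" "256 * B\<^sup>2"] \<gamma>6 c d B
    by (auto simp: \<gamma>_def D_def)
  have z: "\<gamma> * D - 1 \<le> (cmod z)\<^sup>2" "(cmod z)\<^sup>2 \<le> \<gamma> * D + 1"
  proof -
    have "(cmod z)\<^sup>2 = cmod (c * d - 1)"
      by (simp add: sq norm_power)
    then show "\<gamma> * D - 1 \<le> (cmod z)\<^sup>2" "(cmod z)\<^sup>2 \<le> \<gamma> * D + 1"
      using norm_triangle_ineq2[of "c * d" 1] norm_triangle_ineq4[of "c * d" 1]
      by (simp_all add: norm_mult \<gamma>_def D_def)
  qed
  have z0: "0 < cmod z"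
    using z(1) \<gamma>D by (auto intro: ccontr)
  have k4: "64 \<le> (4 :: real) ^ k"
    using power_increasing[OF k(1), of "4 :: real"] by simp
  have four: "(2 :: real) ^ (2 * k) = 4 ^ k"
    by (simp add: power_mult)
  \<comment> \<open>the factors \<open>256 / 108 > 2\<close> and \<open>1024 / 512 = 2\<close> give \<open>2 ^ (2 k) \<ge> 64\<close>, which absorbs all constants\<close>
  have main_small: "4 * cmod z * (108 * B\<^sup>2) ^ k < \<gamma> ^ (2 * k)"
  proof (rule power2_less_imp_less)
    have "64 * (108 * B\<^sup>2) ^ (2 * k) \<le> 4 ^ k * (108 * B\<^sup>2) ^ (2 * k)"
      using k4 by (intro mult_right_mono) auto
    also have "\<dots> = (2 * (108 * B\<^sup>2)) ^ (2 * k)"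
      by (simp only: power_mult_distrib[of 2 "108 * B\<^sup>2"] four)
    also have "\<dots> \<le> (256 * B\<^sup>2) ^ (2 * k)"
      by (intro power_mono) auto
    finally have le: "64 * (108 * B\<^sup>2) ^ (2 * k) \<le> (256 * B\<^sup>2) ^ (2 * k)" .
    have "32 * (\<gamma> * D) * M \<le> \<gamma> * D * N / 2" if "64 * M \<le> N" for M N
      using mult_left_mono[OF that, of "\<gamma> * D"] \<gamma>D by (simp add: mult_ac)
    from this[OF le]
    have "32 * (\<gamma> * D) * (108 * B\<^sup>2) ^ (2 * k) \<le> \<gamma> * D * (256 * B\<^sup>2) ^ (2 * k) / 2" .
    also have "\<dots> \<le> \<gamma> ^ (4 * k) / 2"
      using k(3) by simp
    also have "\<dots> < \<gamma> ^ (4 * k)"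
      using \<gamma>6 by simp
    also have "\<dots> = (\<gamma> ^ (2 * k))\<^sup>2"
      by (simp flip: power_mult)
    finally have "32 * (\<gamma> * D) * (108 * B\<^sup>2) ^ (2 * k) < (\<gamma> ^ (2 * k))\<^sup>2" .
    moreover have "(4 * cmod z * (108 * B\<^sup>2) ^ k)\<^sup>2 = 16 * (cmod z)\<^sup>2 * (108 * B\<^sup>2) ^ (2 * k)"
      by (simp only: power_mult_distrib power_even_eq) simp
    moreover have "16 * (cmod z)\<^sup>2 * (108 * B\<^sup>2) ^ (2 * k) \<le> 32 * (\<gamma> * D) * (108 * B\<^sup>2) ^ (2 * k)"
    proof (rule mult_right_mono)
      show "16 * (cmod z)\<^sup>2 \<le> 32 * (\<gamma> * D)"
        using z(2) \<gamma>D by linarith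
    qed simp
    ultimately show "(4 * cmod z * (108 * B\<^sup>2) ^ k)\<^sup>2 < (\<gamma> ^ (2 * k))\<^sup>2"
      by linarith
  qed (use \<gamma>6 in simp)
  have rest_small: "2 * ((512 * B ^ 5) ^ k * \<gamma> ^ (k + 1)) \<le> cmod z"
  proof (rule power2_le_imp_le)
    define M E where "M = (512 * B ^ 5) ^ (2 * k)" and "E = \<gamma> ^ (2 * k + 1) * \<gamma>"
    have square: "(2 * ((512 * B ^ 5) ^ k * \<gamma> ^ (k + 1)))\<^sup>2 = 4 * (M * E)"
    proof -
      have "E = \<gamma> ^ (2 * (k + 1))"
        by (simp add: E_def)
      then show ?thesis
        by (simp only: power_mult_distrib[of 2] power_mult_distrib[of "(512 * B ^ 5) ^ k"] M_def power_even_eq) simp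
    qed
    have "0 \<le> M * E"
      using B \<gamma>6 by (simp add: M_def E_def)
    then have "64 * (M * E) \<le> 4 ^ k * (M * E)"
      using k4 by (intro mult_right_mono) auto
    also have "\<dots> = (2 * (512 * B ^ 5)) ^ (2 * k) * E"
      by (simp only: power_mult_distrib[of 2 "512 * B ^ 5"] four M_def mult.assoc)
    also have "2 * (512 * B ^ 5) = 1024 * B ^ 5"
      by simp
    also have "(1024 * B ^ 5) ^ (2 * k) * E \<le> D * \<gamma>"
      using mult_right_mono[OF k(2), of \<gamma>] \<gamma>6 unfolding E_def mult.assoc by linarith
    finally have "64 * (M * E) \<le> \<gamma> * D"
      by (simp only: mult.commute)
    then show "(2 * ((512 * B ^ 5) ^ k * \<gamma> ^ (k + 1)))\<^sup>2 \<le> (cmod z)\<^sup>2"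
      unfolding square using z(1) \<gamma>D by linarith
  qed simp
  have c0: "c \<noteq> 0" and a0: "a \<noteq> 0" "b \<noteq> 0"
    using \<gamma>6 ab by (auto simp: \<gamma>_def)

  interpret reciprocal_nodes a b
    by standard (use a0 ab in auto)

  define X where "X = - 1 / c"
  have normX: "cmod X = 1 / \<gamma>" and X0: "X \<noteq> 0"
    using c0 by (simp_all add: X_def \<gamma>_def norm_divide)
  have X2: "cmod X \<le> 1 / 2"
    unfolding normX using \<gamma>6 by (simp add: field_simps)
  have node_le: "cmod (node i) \<le> 1 / 3" for i
    using ab by (auto simp: node_def norm_divide divide_simps)
  have close: "cmod (node i * X) \<le> 1 / 3 * (1 / 2)" for i
    unfolding norm_mult using node_le X2 by (intro mult_mono) auto
  have base_le: "cmod (1 + node i * X) \<le> 2" for i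
    using norm_triangle_ineq[of 1 "node i * X"] close[of i] by simp
  have base0: "1 + node i * X \<noteq> 0" for i
  proof
    assume "1 + node i * X = 0"
    then have "node i * X = - 1"
      by (simp add: eq_neg_iff_add_eq_0 add.commute)
    then show False
      using close[of i] by simp
  qed

  \<comment> \<open>\<open>f i h\<close> is the Taylor coefficient of order \<open>h\<close> of the power series at the \<open>i\<close>-th node\<close>
  define \<alpha> :: complex where "\<alpha> = of_nat k + 1 / 2"
  define f where "f i h = (\<alpha> gchoose h) * X ^ h * (1 + node i * X) powr (\<alpha> - of_nat h)" for i h
  define root where "root i = (1 + node i * X) powr (1 / 2)" for i
  have root_sq: "(root i)\<^sup>2 = 1 + node i * X" for i
    using base0[of i] by (simp add: root_def power2_eq_square flip: powr_add)
  have root0: "root i \<noteq> 0" for i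
    using base0[of i] root_sq[of i] by auto
  have f: "f i h = (\<alpha> gchoose h) * X ^ h * (1 + node i * X) ^ (k - h) * root i" if "h \<le> k" for i h
  proof -
    have "\<alpha> - of_nat h = of_nat (k - h) + 1 / 2"
      using that by (simp add: \<alpha>_def of_nat_diff)
    then have "(1 + node i * X) powr (\<alpha> - of_nat h) = (1 + node i * X) ^ (k - h) * root i"
      using base0[of i] by (simp add: powr_add root_def powr_nat')
    then show ?thesis
      by (simp add: f_def)
  qed
  have root_le: "cmod (root i) \<le> 2" for i
  proof -
    have "(cmod (root i))\<^sup>2 \<le> 2\<^sup>2"
      using base_le[of i] root_sq[of i] by (simp flip: norm_power)
    then show ?thesis
      by (rule power2_le_imp_le) simp
  qed
  have f_le: "cmod (f i h) \<le> 2 * 4 ^ k" if "h \<le> k" for i h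
  proof -
    have "cmod (f i h) = cmod (\<alpha> gchoose h) * cmod X ^ h * cmod (1 + node i * X) ^ (k - h) * cmod (root i)"
      using f[OF that, of i] by (simp add: norm_mult norm_power)
    also have "\<dots> \<le> 2 ^ k * 1 * 2 ^ k * 2"
    proof (intro mult_mono)
      show "cmod (\<alpha> gchoose h) \<le> 2 ^ k"
        unfolding \<alpha>_def by (rule half_integer_gbinomial_bound)
      show "cmod X ^ h \<le> 1"
        using X2 by (intro power_le_one) auto
      have "cmod (1 + node i * X) ^ (k - h) \<le> 2 ^ (k - h)"
        using base_le by (intro power_mono) auto
      also have "\<dots> \<le> 2 ^ k"
        by (intro power_increasing) auto
      finally show "cmod (1 + node i * X) ^ (k - h) \<le> 2 ^ k" .
    qed (use root_le in auto)
    also have "\<dots> = 2 * 4 ^ k"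
      by (simp flip: power_mult_distrib)
    finally show ?thesis .
  qed

  \<comment> \<open>the sign \<open>\<sigma>\<close> selects the square root that is close to \<open>z\<close>\<close>
  have choice: "\<exists>\<sigma>. (\<sigma> = 1 \<or> \<sigma> = -1) \<and> cmod (\<sigma> * (s' * x' / e / root i) - z) \<le> \<gamma> / (2 * cmod z)"
    if e: "3 \<le> cmod e" "e * c - 1 = s'\<^sup>2" "e * d - 1 = x'\<^sup>2" "node i = 1 / e" for e s' x' i
  proof -
    define p where "p = s' * x' / e / root i"
    have "e \<noteq> 0"
      using e(1) by auto
    have "e * c - 1 \<noteq> 0"
      using base0[of i] c0 \<open>e \<noteq> 0\<close> by (auto simp: e(4) X_def field_simps)
    have "p\<^sup>2 = (e * c - 1) * (e * d - 1) / e\<^sup>2 / (1 + 1 / e * X)"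
      by (simp add: p_def power_divide power_mult_distrib root_sq e)
    also have "\<dots> = c * d - c / e"
      using \<open>e \<noteq> 0\<close> c0 \<open>e * c - 1 \<noteq> 0\<close> by (simp add: X_def field_simps power2_eq_square)
    finally have "p\<^sup>2 - z\<^sup>2 = 1 - c / e"
      by (simp add: sq(10)[symmetric])
    then have "cmod (p\<^sup>2 - z\<^sup>2) \<le> 1 + \<gamma> / cmod e"
      using norm_triangle_ineq4[of 1 "c / e"] by (simp add: norm_divide \<gamma>_def)
    also have "\<dots> \<le> 1 + \<gamma> / 3"
      using e(1) \<gamma>6 by (intro add_left_mono divide_left_mono) auto
    also have "\<dots> \<le> \<gamma> / 2"
      using \<gamma>6 by simp
    finally have le: "cmod (p\<^sup>2 - z\<^sup>2) \<le> \<gamma> / 2" .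
    obtain \<sigma> :: complex where \<sigma>: "\<sigma> = 1 \<or> \<sigma> = -1" "cmod (\<sigma> * p - z) * cmod z \<le> cmod (p\<^sup>2 - z\<^sup>2)"
      by (rule close_square_root)
    then have "cmod (\<sigma> * p - z) \<le> \<gamma> / (2 * cmod z)"
      using le z0 by (simp add: field_simps)
    with \<sigma>(1) show ?thesis
      unfolding p_def by blast
  qed
  obtain \<sigma>1 :: complex where \<sigma>1: "\<sigma>1 = 1 \<or> \<sigma>1 = -1"
      "cmod (\<sigma>1 * (s * x / a / root 1) - z) \<le> \<gamma> / (2 * cmod z)"
    using choice[of a s x 1] ab sq by (auto simp: node_def)
  obtain \<sigma>2 :: complex where \<sigma>2: "\<sigma>2 = 1 \<or> \<sigma>2 = -1"
      "cmod (\<sigma>2 * (t * y / b / root 2) - z) \<le> \<gamma> / (2 * cmod z)"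
    using choice[of b t y 2] ab sq by (auto simp: node_def)
  define \<kappa> where "\<kappa> i = (if i = 0 then z else if i = 1 then \<sigma>1 * (s * x / a / root 1)
    else \<sigma>2 * (t * y / b / root 2))" for i :: nat
  define g where "g i h = \<kappa> i * f i h" for i h
  define g' where "g' i h = (\<kappa> i - z) * f i h" for i h
  define \<eta> where "\<eta> = \<gamma> / (2 * cmod z)"
  have \<kappa>: "\<kappa> 0 = z" "cmod (\<kappa> 1 - z) \<le> \<eta>" "cmod (\<kappa> 2 - z) \<le> \<eta>"
    using \<sigma>1 \<sigma>2 by (simp_all add: \<kappa>_def \<eta>_def)
  have \<eta>0: "0 \<le> \<eta>"
    using \<gamma>6 z0 by (simp add: \<eta>_def)

  have vanish: "divided_difference g p q r = 0"
    if pqr: "k \<le> p" "k \<le> q" "k \<le> r" "p + q + r = 3 * k + 1" for p q r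
  proof -
    define \<Phi> where "\<Phi> = 4 ^ k * c ^ k * ((b - a) ^ (2 * k) * divided_difference g p q r)"
    have "\<Phi> \<in> R"
    proof -
      define G where "G i h = 4 ^ k * c ^ k * g i h" for i h
      have "\<Phi> = (b - a) ^ (2 * k) * divided_difference G p q r"
        unfolding \<Phi>_def G_def[abs_def] divided_difference_scale by (simp only: mult_ac)
      also have "\<dots> \<in> R"
      proof (rule divided_difference_integral)
        show "quadratic_order R"
          by (rule quadratic_order_axioms)
        fix h assume h: "h \<le> k"
        have "G 0 h = 4 ^ (k - h) * (4 ^ h * (\<alpha> gchoose h)) * (- 1) ^ h * c ^ (k - h) * z"
        proof -
          have "root 0 = 1"
            by (simp add: root_def)
          moreover have "(4 :: complex) ^ k = 4 ^ (k - h) * 4 ^ h" "c ^ k = c ^ (k - h) * c ^ h"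
            using h by (simp_all flip: power_add)
          moreover have "(- (1 / c)) ^ h = (- 1) ^ h / c ^ h"
            by (metis power_divide minus_divide_left)
          ultimately show ?thesis
            using c0 by (simp add: G_def g_def f[OF h] \<kappa> X_def)
        qed
        also have "\<dots> \<in> R"
        proof -
          have "4 ^ (k - h) * J * (- 1) ^ h * c ^ (k - h) * z \<in> R" if "J \<in> R" for J
            using that R sq by (intro mult_mem power_mem numeral_mem uminus_mem one_mem)
          from this[OF int_mem[OF half_integer_gbinomial_Ints]] show ?thesis
            unfolding \<alpha>_def .
        qed
        finally show "G 0 h \<in> R" .
        have "a ^ Suc k * G 1 h = a ^ Suc k * (4 ^ k * c ^ k *
            ((\<alpha> gchoose h) * (- 1 / c) ^ h * (1 + 1 / a * (- 1 / c)) ^ (k - h) * (s * (\<sigma>1 * x) / a)))"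
          using root0[of 1] by (simp add: G_def g_def f[OF h] \<kappa>_def X_def)
        also have "\<dots> \<in> R"
          unfolding \<alpha>_def
          by (rule scaled_taylor_coeff_integral[OF R(1,3) sq(1) _ a0(1) c0 sq(2) h])
             (use \<sigma>1(1) sq(5) uminus_mem in auto)
        finally show "a ^ Suc k * G 1 h \<in> R" .
        have "b ^ Suc k * G 2 h = b ^ Suc k * (4 ^ k * c ^ k *
            ((\<alpha> gchoose h) * (- 1 / c) ^ h * (1 + 1 / b * (- 1 / c)) ^ (k - h) * (t * (\<sigma>2 * y) / b)))"
          using root0[of 2] by (simp add: G_def g_def f[OF h] \<kappa>_def X_def)
        also have "\<dots> \<in> R"
          unfolding \<alpha>_def
          by (rule scaled_taylor_coeff_integral[OF R(2,3) sq(3) _ a0(2) c0 sq(4) h])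
             (use \<sigma>2(1) sq(7) uminus_mem in auto)
        finally show "b ^ Suc k * G 2 h \<in> R" .
      qed (use R k pqr in auto)
      finally show ?thesis .
    qed
    moreover have "cmod \<Phi> < 1"
    proof -
      have "g = (\<lambda>i h. z * f i h + g' i h)"
        by (simp add: g_def g'_def fun_eq_iff algebra_simps)
      then have split: "divided_difference g p q r = z * divided_difference f p q r + divided_difference g' p q r"
        by (simp only: divided_difference_add divided_difference_scale)
      \<comment> \<open>the part of the common factor \<open>z\<close>, then the part of the deviations \<open>\<kappa> i - z\<close>\<close>
      have main: "cmod (divided_difference f p q r) \<le> 2 * 2 ^ k * (3 / 2) ^ (3 * k) * (1 / \<gamma>) ^ (3 * k)"
        using divided_difference_binomial_bound[OF _ _ _ X2, of p q r "3 * k" k] node_le[of 0] node_le[of 1] node_le[of 2] pqr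
        by (simp add: f_def[abs_def] \<alpha>_def normX)
      have rest: "cmod ((b - a) ^ (2 * k) * divided_difference g' p q r) \<le> (2 * B) ^ (5 * k) * (\<eta> * (2 * 4 ^ k))"
      proof (rule divided_difference_bound)
        show "g' 0 h = 0" for h
          by (simp add: g'_def \<kappa>)
        show "cmod (g' 1 h) \<le> \<eta> * (2 * 4 ^ k)" "cmod (g' 2 h) \<le> \<eta> * (2 * 4 ^ k)" if "h \<le> k" for h
          unfolding g'_def norm_mult using \<kappa> f_le[OF that] \<eta>0 by (intro mult_mono; simp)+
      qed (use B ab \<eta>0 k pqr in auto)
      have \<delta>: "cmod ((b - a) ^ (2 * k)) \<le> (2 * B) ^ (2 * k)"
        unfolding norm_power using norm_triangle_ineq4[of b a] ab by (intro power_mono) auto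
      have "\<Phi> = 4 ^ k * c ^ k * ((b - a) ^ (2 * k) * (z * divided_difference f p q r))
          + 4 ^ k * c ^ k * ((b - a) ^ (2 * k) * divided_difference g' p q r)"
        by (simp add: \<Phi>_def split algebra_simps)
      then have "cmod \<Phi> \<le> cmod (4 ^ k * c ^ k * ((b - a) ^ (2 * k) * (z * divided_difference f p q r)))
          + cmod (4 ^ k * c ^ k * ((b - a) ^ (2 * k) * divided_difference g' p q r))"
        by (metis norm_triangle_ineq)
      also have "cmod (4 ^ k * c ^ k * ((b - a) ^ (2 * k) * (z * divided_difference f p q r)))
          \<le> 4 ^ k * \<gamma> ^ k * ((2 * B) ^ (2 * k) * (cmod z * (2 * 2 ^ k * (3 / 2) ^ (3 * k) * (1 / \<gamma>) ^ (3 * k))))"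
        unfolding norm_mult using \<delta> main B \<gamma>6
        by (intro mult_mono mult_nonneg_nonneg) (simp_all add: norm_power \<gamma>_def)
      also have "\<dots> = 2 * cmod z * (108 * B\<^sup>2) ^ k / \<gamma> ^ (2 * k)"
      proof -
        have "\<gamma> ^ (3 * k) = \<gamma> ^ k * \<gamma> ^ (2 * k)"
          by (simp flip: power_add)
        moreover have "(108 * B\<^sup>2) ^ k = 4 ^ k * (2 * B) ^ (2 * k) * 2 ^ k * (3 / 2) ^ (3 * k)"
        proof -
          have "108 * B\<^sup>2 = 4 * (2 * B)\<^sup>2 * 2 * (3 / 2) ^ 3"
            by (simp add: power2_eq_square power3_eq_cube)
          then show ?thesis
            by (simp only: power_mult_distrib power_mult)
        qed
        ultimately show ?thesis
          using \<gamma>6 by (simp add: power_divide field_simps)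
      qed
      also have "\<dots> < 1 / 2"
        using main_small z0 \<gamma>6 by (simp add: field_simps)
      also have "cmod (4 ^ k * c ^ k * ((b - a) ^ (2 * k) * divided_difference g' p q r))
          \<le> 4 ^ k * \<gamma> ^ k * ((2 * B) ^ (5 * k) * (\<eta> * (2 * 4 ^ k)))"
        using rest \<gamma>6 unfolding norm_mult[of "4 ^ k * c ^ k"]
        by (intro mult_mono) (simp_all add: norm_mult norm_power \<gamma>_def)
      also have "\<dots> = (512 * B ^ 5) ^ k * \<gamma> ^ (k + 1) / cmod z"
      proof -
        have "(512 * B ^ 5) ^ k = 4 ^ k * (2 * B) ^ (5 * k) * 4 ^ k"
        proof -
          have "512 * B ^ 5 = 4 * (2 * B) ^ 5 * 4"
            by (simp add: power_mult_distrib)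
          then show ?thesis
            by (simp only: power_mult_distrib power_mult)
        qed
        then show ?thesis
          using z0 by (simp add: \<eta>_def field_simps)
      qed
      also have "\<dots> \<le> 1 / 2"
        using rest_small z0 by (simp add: field_simps)
      finally show ?thesis
        by simp
    qed
    ultimately have "\<Phi> = 0"
      by (rule eq_0_if_norm_less_1)
    then show ?thesis
      using c0 ab by (simp add: \<Phi>_def)
  qed

  have "g 0 0 = 0"
  proof (rule divided_differences_not_all_zero[where g = g and k = k and \<alpha> = \<alpha> and x = X])
    show "\<alpha> \<notin> \<nat>"
    proof
      assume "\<alpha> \<in> \<nat>"
      then obtain n where "\<alpha> = of_nat n"
        by (elim Nats_cases)
      then have "Re (2 * \<alpha>) = Re (2 * of_nat n)"
        by simp
      then have "2 * real k + 1 = 2 * real n"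
        by (simp add: \<alpha>_def)
      then have "2 * k + 1 = 2 * n"
        by linarith
      then show False
        by presburger
    qed
    show "(1 + node i * X) * (of_nat (Suc h) * g i (Suc h)) = (\<alpha> - of_nat h) * X * g i h"
      if "i < 3" "h < k" for i h
    proof -
      have "k - h = Suc (k - Suc h)"
        using that by simp
      then have "(1 + node i * X) * (of_nat (Suc h) * g i (Suc h)) - (\<alpha> - of_nat h) * X * g i h
          = \<kappa> i * X ^ Suc h * (1 + node i * X) ^ (k - h) * root i
            * ((\<alpha> gchoose Suc h) * of_nat (Suc h) - (\<alpha> gchoose h) * (\<alpha> - of_nat h))"
        using that by (simp add: g_def f algebra_simps)
      then show ?thesis
        by (simp only: gbinomial_Suc_times diff_self mult_zero_right right_minus_eq)
    qed
  qed (use k X0 in \<open>auto intro!: vanish\<close>)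
  moreover have "g 0 0 = z"
    by (simp add: g_def f_def \<kappa>)
  ultimately show False
    using z0 by simp
qed

end

section \<open>The bound for Diophantine tuples\<close>

theorem theorem1p1:
  fixes K :: "complex set" and m :: nat
  assumes "imaginary_quadratic_field K"
    and "m > 36"
  shows "\<not> (\<exists>A. diophantine_tuple_minus_one (ring_of_integers K) m A)"
proof
  assume "\<exists>A. diophantine_tuple_minus_one (ring_of_integers K) m A"
  then obtain A where A: "finite A" "card A = m" "A \<subseteq> ring_of_integers K - {0}"
    and sq: "\<And>a b. a \<in> A \<Longrightarrow> b \<in> A \<Longrightarrow> a \<noteq> b \<Longrightarrow> \<exists>x\<in>ring_of_integers K. a * b - 1 = x\<^sup>2"
    by (auto simp: diophantine_tuple_minus_one_def)
  interpret quadratic_order "ring_of_integers K"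
    using assms(1) by (rule quadratic_order_ring_of_integers)
  interpret diophantine_set "ring_of_integers K" A
    by unfold_locales (use A sq in auto)
  have "card ({a \<in> A. cmod a < 3} \<union> {a \<in> A. 3 \<le> cmod a})
      = card {a \<in> A. cmod a < 3} + card {a \<in> A. 3 \<le> cmod a}"
    using A(1) by (intro card_Un_disjoint) auto
  moreover have "{a \<in> A. cmod a < 3} \<union> {a \<in> A. 3 \<le> cmod a} = A"
    by auto
  moreover have "card {a \<in> A. cmod a < 3} \<le> 20"
    using A sq by (intro card_small_diophantine_le_20) auto
  ultimately have "17 \<le> card {a \<in> A. 3 \<le> cmod a}"
    using A(2) assms(2) by simp
  then obtain a b c d where abcd: "a \<in> A" "b \<in> A" "c \<in> A" "d \<in> A" "a \<noteq> b"
    and ab: "3 \<le> cmod a" "cmod a \<le> cmod b"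
    and c: "6 ^ 21 * (2 * cmod b) ^ 34 \<le> 2 * cmod c" and d: "(2 * cmod c) ^ 8 \<le> 2 * cmod d"
    using fast_growing_quadruple by blast
  define B where "B = cmod b"
  have B: "3 \<le> B"
    using ab by (simp add: B_def)
  have power: "0 \<le> B ^ n" for n
    using B by simp
  \<comment> \<open>\<open>6 ^ 21 2 ^ 33\<close> exceeds \<open>2 ^ 87\<close>, which is short of \<open>2 ^ 96\<close>; \<open>B ^ 10 \<ge> 3 ^ 10\<close> makes up for it\<close>
  have c34: "6 ^ 21 * 2 ^ 33 * B ^ 34 \<le> cmod c"
    using c by (simp add: power_mult_distrib flip: B_def)
  have "B ^ 24 * 3 ^ 10 \<le> B ^ 24 * B ^ 10"
    using B by (intro mult_left_mono power_mono) auto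
  then have B34: "59049 * B ^ 24 \<le> B ^ 34"
    by (simp flip: power_add)
  have "(256 * B\<^sup>2) ^ 12 = 2 ^ 96 * B ^ 24"
    by (simp add: power_mult_distrib flip: power_mult)
  also have "\<dots> \<le> 6 ^ 21 * 2 ^ 33 * 59049 * B ^ 24"
    using power[of 24] by (intro mult_right_mono) simp_all
  also have "\<dots> = 6 ^ 21 * 2 ^ 33 * (59049 * B ^ 24)"
    by (simp only: mult.assoc)
  also have "\<dots> \<le> 6 ^ 21 * 2 ^ 33 * B ^ 34"
    by (intro mult_left_mono B34) simp
  also note c34
  finally have c2: "(256 * B\<^sup>2) ^ 12 \<le> cmod c" .
  have "B ^ 30 * 1 \<le> B ^ 30 * B ^ 4"
    using B by (intro mult_left_mono one_le_power) auto
  then have B34': "B ^ 30 \<le> B ^ 34"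
    by (simp flip: power_add)
  have "(1024 * B ^ 5) ^ 6 = 2 ^ 60 * B ^ 30"
    by (simp add: power_mult_distrib flip: power_mult)
  also have "\<dots> \<le> 6 ^ 21 * 2 ^ 33 * B ^ 34"
    using power[of 30] by (intro mult_mono B34') simp_all
  also note c34
  finally have c1: "(1024 * B ^ 5) ^ 6 \<le> cmod c" .
  have "B ^ 1 \<le> B ^ 30"
    using B by (intro power_increasing) auto
  then have bc: "cmod b < cmod c"
    using c1 B by (simp add: power_mult_distrib flip: B_def power_mult)
  then have c3: "3 < cmod c"
    using B by (simp add: B_def)
  have d1: "cmod c ^ 8 \<le> cmod d"
  proof -
    have "128 * cmod c ^ 8 \<le> cmod d"
      using d by (simp add: power_mult_distrib)
    moreover have "0 \<le> cmod c ^ 8"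
      by simp
    ultimately show ?thesis
      by linarith
  qed
  have "cmod c ^ 1 < cmod c ^ 8"
    using c3 by (intro power_strict_increasing) auto
  then have cd: "cmod c < cmod d"
    using d1 by simp
  have ne: "a \<noteq> c" "b \<noteq> c" "a \<noteq> d" "b \<noteq> d" "c \<noteq> d"
    using ab bc cd by auto
  obtain s where s: "s \<in> ring_of_integers K" "a * c - 1 = s\<^sup>2"
    using sq[OF abcd(1,3) ne(1)] by blast
  obtain t where t: "t \<in> ring_of_integers K" "b * c - 1 = t\<^sup>2"
    using sq[OF abcd(2,3) ne(2)] by blast
  obtain x where x: "x \<in> ring_of_integers K" "a * d - 1 = x\<^sup>2"
    using sq[OF abcd(1,4) ne(3)] by blast
  obtain y where y: "y \<in> ring_of_integers K" "b * d - 1 = y\<^sup>2"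
    using sq[OF abcd(2,4) ne(4)] by blast
  obtain z where z: "z \<in> ring_of_integers K" "c * d - 1 = z\<^sup>2"
    using sq[OF abcd(3,4) ne(5)] by blast
  have "cmod a \<le> B" "3 \<le> cmod b" "cmod b \<le> B"
    using ab by (simp_all add: B_def)
  then show False
    using no_far_extension[OF abcd(1-4)[THEN mem_R] s t x y z abcd(5) ab(1) _ _ _ c1 c2 d1] by blast
qed

end
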